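(* Let $f\in C^{1,1}(B_{10}\times\mathbb{R})$ be a positive function and let $u\in C^4(B_{10})$ be a convex solution of $$\frac{\sigma_2(D^2u)}{\sigma_1(D^2u)}=f(x,u)\quad\text{in } B_{10}\subset\mathbb{R}^2.$$ Then $$|D^2u(0)|\leq C,$$ where $C$ depends only on $\|u\|_{C^{0,1}(\overline{B}_9)}$, $\min_{\overline{B}_9\times[-M,M]}f$ and $\|f\|_{C^{1,1}(\overline{B}_9\times[-M,M])}$. Here $M$ is a large constant satisfying $\|u\|_{L^\infty(\overline{B}_9)}\leq M$.
   Context: $B_r\subset\mathbb{R}^2$ is the open disc of radius $r$ centered at the origin. For a symmetric $2\times 2$ matrix $A$, $\sigma_1(A)$ is its trace and $\sigma_2(A)$ its determinant. The right-hand side $f(x,u)$ means $f(x,u(x))$. *)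

theory Defs
  imports "HOL-Analysis.Analysis"
begin

text \<open>The gradient and the Hessian are built from \<^const>\<open>frechet_derivative\<close> at full neighbourhoods, so they
  are meaningful where the function is differentiable in a neighbourhood of the point; below
  they are only evaluated inside the open set on which the function is smooth.\<close>

definition grad :: "('a::euclidean_space \<Rightarrow> real) \<Rightarrow> 'a \<Rightarrow> 'a" where
  "grad f x = (\<Sum>b\<in>Basis. frechet_derivative f (at x) b *\<^sub>R b)"

definition pderiv_at :: "'n::finite \<Rightarrow> (real ^ 'n \<Rightarrow> real) \<Rightarrow> real ^ 'n \<Rightarrow> real" where
  "pderiv_at i f x = frechet_derivative f (at x) (axis i 1)"

definition hessian :: "(real ^ 'n \<Rightarrow> real) \<Rightarrow> real ^ 'n \<Rightarrow> real ^ 'n ^ 'n" where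
  "hessian f x = (\<chi> i j. pderiv_at j (pderiv_at i f) x)"

definition sigma1 :: "real ^ 2 ^ 2 \<Rightarrow> real" where
  "sigma1 A = trace A"

definition sigma2 :: "real ^ 2 ^ 2 \<Rightarrow> real" where
  "sigma2 A = det A"

text \<open>\<open>k\<close> times continuously differentiable on an open set \<open>S\<close>.\<close>

fun Ck_on :: "nat \<Rightarrow> 'a::euclidean_space set \<Rightarrow> ('a \<Rightarrow> real) \<Rightarrow> bool" where
  "Ck_on 0 S f \<longleftrightarrow> continuous_on S f"
| "Ck_on (Suc k) S f \<longleftrightarrow>
     (\<forall>x\<in>S. f differentiable (at x)) \<and> 
     (\<forall>v. Ck_on k S (\<lambda>x. frechet_derivative f (at x) v))"

text \<open>For an open set \<open>S\<close>, \<open>C\<^sup>1\<^sup>,\<^sup>1(S)\<close> is understood in the usual local sense: the gradient is Lipschitz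
  on every compact subset of \<open>S\<close>; no bound up to the boundary or at infinity is imposed.\<close>

definition C11_on :: "'a::euclidean_space set \<Rightarrow> ('a \<Rightarrow> real) \<Rightarrow> bool" where
  "C11_on S f \<longleftrightarrow> Ck_on 1 S f \<and>
     (\<forall>K. compact K \<and> K \<subseteq> S \<longrightarrow> (\<exists>L. L-lipschitz_on K (grad f)))"

text \<open>The norms are real-valued suprema. They are the intended ones only when the suprema are taken over
  nonempty bounded sets, as is the case for (locally) regular functions on a compact set
  with at least two points.\<close>

definition sup_norm :: "'a set \<Rightarrow> ('a \<Rightarrow> 'b::real_normed_vector) \<Rightarrow> real" where
  "sup_norm S g = (SUP x\<in>S. norm (g x))"

definition lip_seminorm :: "'a::metric_space set \<Rightarrow> ('a \<Rightarrow> 'b::metric_space) \<Rightarrow> real" where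
  "lip_seminorm S g = (SUP (x, y)\<in>{(x, y). x \<in> S \<and> y \<in> S \<and> x \<noteq> y}. dist (g x) (g y) / dist x y)"

definition C01_norm :: "'a::euclidean_space set \<Rightarrow> ('a \<Rightarrow> real) \<Rightarrow> real" where
  "C01_norm S g = sup_norm S g + lip_seminorm S g"

definition C11_norm :: "'a::euclidean_space set \<Rightarrow> ('a \<Rightarrow> real) \<Rightarrow> real" where
  "C11_norm S g = sup_norm S g + sup_norm S (grad g) + lip_seminorm S (grad g)"

text \<open>Convex \<open>C\<^sup>4\<close> solutions. Since \<open>t / 0 = 0\<close>, for positive \<open>f\<close> the equation forces
  \<open>sigma1 (hessian u x) \<noteq> 0\<close>.\<close>

definition convex_C4_solution :: "(real ^ 2) set \<Rightarrow> ((real ^ 2) \<times> real \<Rightarrow> real) \<Rightarrow> (real ^ 2 \<Rightarrow> real) \<Rightarrow> bool" where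
  "convex_C4_solution S f u \<longleftrightarrow> Ck_on 4 S u \<and> convex_on S u \<and>
     (\<forall>x\<in>S. sigma2 (hessian u x) / sigma1 (hessian u x) = f (x, u x))"

end

theory Submission
  imports Defs
begin

text \<open>
  Let \<open>W\<close> be the inverse of the Hessian of \<open>u\<close>. The equation says that the trace of \<open>W\<close> is \<open>h = 1 / f\<close>.
  In the variable \<open>y = Du(x)\<close> the matrix \<open>W\<close> is the Hessian of the Legendre transform of \<open>u\<close>, which
  therefore solves a Poisson equation with right-hand side \<open>h\<close>. So \<open>W\<close> is bounded above, and
  bounding the Hessian of \<open>u\<close> at the origin amounts to bounding \<open>We \<bullet> e\<close> from below there, for
  every unit vector \<open>e\<close>. The whole argument is one application of the maximum principle to the
  Laplacian in \<open>y\<close>, for a fixed \<open>e\<close> with orthogonal unit vector \<open>n\<close>; write \<open>v = We \<bullet> e\<close>.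

  The function \<open>v\<close> is a positive almost-supersolution: differentiating the Poisson equation twice in
  the direction \<open>e\<close> gives \<open>lap v \<le> C v + C \<bar>grad v\<bar>\<close> (\<open>lap_wee\<close>, \<open>lap_lw_le\<close>). Its
  right-hand side involves second derivatives of \<open>h\<close> only along \<open>\<xi> = We\<close>. Those of \<open>x \<mapsto> f(x, u(x))\<close>
  are \<open>f\<^sub>u u\<^sub>\<xi>\<^sub>\<xi>\<close> up to a multiple of \<open>\<bar>\<xi>\<bar>\<^sup>2\<close>, for which a Lipschitz gradient of \<open>f\<close> suffices
  (\<open>composed_rhs_bounds\<close>), and \<open>u\<^sub>\<xi>\<^sub>\<xi> = v\<close> and \<open>\<bar>\<xi>\<bar>\<^sup>2 \<le> h v\<close>.
  For a small power \<open>p\<close> the gradient term is absorbed and the zeroth-order coefficient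
  is as small as desired, so that a bounded factor \<open>\<zeta>\<close>, concave in \<open>y\<close>, produces
  \<open>lap (\<zeta> v\<^sup>p) \<le> - v\<^sup>p\<close> on the whole domain (\<open>lap_G_le\<close>).

  Where \<open>v\<close> is tiny, \<open>W\<close> is almost a multiple of the projection onto \<open>n\<close>: the coordinate \<open>x \<bullet> e\<close>
  then hardly changes with \<open>y\<close>, and \<open>x\<close> hardly changes when \<open>y\<close> moves in the direction \<open>e\<close>. Hence
  the bounded variable \<open>y \<bullet> e\<close> can be used as a free convex direction: for large \<open>k\<close> and \<open>Q\<close> the function
  \<open>A = exp (k (y \<bullet> e)) (1 - (x \<bullet> n)\<^sup>2)\<^sup>2 - Q (x \<bullet> e)\<^sup>2\<close> is positive at the origin, nonpositive on the unit
  circle, and satisfies \<open>lap A \<ge> - C sqrt v \<ge> - C' v\<^sup>p\<close> (\<open>lap_A_ge\<close>). For large \<open>N\<close> the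
  function \<open>A - N \<zeta> v\<^sup>p\<close> has no interior maximum in the unit disc, so it is nonpositive at the origin,
  which is the required lower bound for \<open>v(0)\<close> (\<open>wee_0_ge\<close>). Convexity of \<open>u\<close> makes
  the Hessian positive definite.

  The Legendre transform is never formed: the derivatives in \<open>y\<close> are the vector fields given by the rows
  of \<open>W\<close>, and everything follows from the fact that these commute.
\<close>

section \<open>Directional derivatives and smoothness classes\<close>

definition dd :: "'a::euclidean_space \<Rightarrow> ('a \<Rightarrow> real) \<Rightarrow> 'a \<Rightarrow> real" where
  "dd v f x = frechet_derivative f (at x) v"

lemma Ck_on_Suc:
  "Ck_on (Suc k) S f \<longleftrightarrow> (\<forall>x\<in>S. f differentiable (at x)) \<and> (\<forall>v. Ck_on k S (dd v f))"
  by (simp add: dd_def[abs_def])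

(* From here on successor smoothness is unfolded through dd, by Ck_on_Suc. *)
declare Ck_on.simps(2) [simp del]

lemma dd_eqI: "(f has_derivative f') (at x) \<Longrightarrow> dd v f x = f' v"
  unfolding dd_def by (metis frechet_derivative_at)

lemma has_derivative_dd: "f differentiable (at x) \<Longrightarrow> (f has_derivative (\<lambda>v. dd v f x)) (at x)"
  unfolding dd_def by (simp add: frechet_derivative_works)

lemma dd_linear: "f differentiable (at x) \<Longrightarrow> linear (\<lambda>v. dd v f x)"
  using has_derivative_dd has_derivative_linear by blast

lemma dd_comb:
  assumes "f differentiable (at x)"
  shows "dd (s *\<^sub>R v + t *\<^sub>R w) f x = s * dd v f x + t * dd w f x"
  by (simp add: linear_add[OF dd_linear[OF assms]] linear_scale[OF dd_linear[OF assms]])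

lemma has_derivative_cong_open:
  assumes "open S" "x \<in> S" "\<And>y. y \<in> S \<Longrightarrow> f y = g y"
  shows "(f has_derivative f') (at x) \<longleftrightarrow> (g has_derivative f') (at x)"
  using assms has_derivative_transform_within_open by (metis (full_types))

text \<open>\<open>frechet_derivative\<close> is a choice among the possible derivatives, and two functions that agree near \<open>x\<close>
  have the same ones, differentiable or not.\<close>

lemma dd_cong_open:
  assumes "open S" "x \<in> S" "\<And>y. y \<in> S \<Longrightarrow> f y = g y"
  shows "dd v f x = dd v g x"
  unfolding dd_def frechet_derivative_def by (simp only: has_derivative_cong_open[OF assms])

lemma dd_add:
  "f differentiable (at x) \<Longrightarrow> g differentiable (at x) \<Longrightarrow>
   dd v (\<lambda>y. f y + g y) x = dd v f x + dd v g x"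
  by (rule dd_eqI) (auto intro!: derivative_eq_intros has_derivative_dd)

lemma dd_sub:
  "f differentiable (at x) \<Longrightarrow> g differentiable (at x) \<Longrightarrow>
   dd v (\<lambda>y. f y - g y) x = dd v f x - dd v g x"
  by (rule dd_eqI) (auto intro!: derivative_eq_intros has_derivative_dd)

lemma dd_uminus: "f differentiable (at x) \<Longrightarrow> dd v (\<lambda>y. - f y) x = - dd v f x"
  by (rule dd_eqI) (auto intro!: derivative_eq_intros has_derivative_dd)

lemma dd_mult:
  "f differentiable (at x) \<Longrightarrow> g differentiable (at x) \<Longrightarrow>
   dd v (\<lambda>y. f y * g y) x = f x * dd v g x + g x * dd v f x"
  by (subst dd_eqI, rule has_derivative_mult, auto intro: has_derivative_dd)

lemma dd_const [simp]: "dd v (\<lambda>y. c) x = 0"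
  by (subst dd_eqI) (auto intro!: derivative_eq_intros)

lemma dd_chain:
  assumes "f differentiable (at x)" "(g has_real_derivative g') (at (f x))"
  shows "dd v (\<lambda>y. g (f y)) x = g' * dd v f x"
  using dd_eqI[OF DERIV_compose_FDERIV[OF assms(2) has_derivative_dd[OF assms(1)]]]
  by (simp add: mult.commute)

lemma dd_inner [simp]: "dd v (\<lambda>y. y \<bullet> w) x = v \<bullet> w"
  by (subst dd_eqI) (auto intro!: derivative_eq_intros)

lemma Ck_on_imp_continuous: "Ck_on k S f \<Longrightarrow> continuous_on S f"
  by (cases k) (auto simp: Ck_on_Suc intro!: continuous_at_imp_continuous_on differentiable_imp_continuous_within)

lemma Ck_on_pred: "Ck_on (Suc k) S f \<Longrightarrow> Ck_on k S f"
proof (induction k arbitrary: f)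
  case 0
  then show ?case using Ck_on_imp_continuous by auto
next
  case (Suc k)
  then show ?case by (simp add: Ck_on_Suc[of _ S f])
qed

lemma Ck_on_mono: "Ck_on k S f \<Longrightarrow> j \<le> k \<Longrightarrow> Ck_on j S f"
  by (induction k) (auto simp: le_Suc_eq intro: Ck_on_pred)

lemma Ck_on_subset: "Ck_on k S f \<Longrightarrow> U \<subseteq> S \<Longrightarrow> Ck_on k U f"
  by (induction k arbitrary: f) (auto simp: Ck_on_Suc intro: continuous_on_subset)

lemma Ck_on_differentiable: "Ck_on k S f \<Longrightarrow> 0 < k \<Longrightarrow> x \<in> S \<Longrightarrow> f differentiable (at x)"
  by (cases k) (auto simp: Ck_on_Suc)

lemma Ck_on_dd: "Ck_on (Suc k) S f \<Longrightarrow> Ck_on k S (dd v f)"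
  by (simp add: Ck_on_Suc)

lemma Ck_on_cong_open:
  assumes "open S" "\<And>x. x \<in> S \<Longrightarrow> f x = g x" "Ck_on k S f"
  shows "Ck_on k S g"
  using assms(2,3)
proof (induction k arbitrary: f g)
  case 0
  then show ?case by (simp cong: continuous_on_cong)
next
  case (Suc k)
  have "g differentiable (at x)" if "x \<in> S" for x
    using Suc.prems that has_derivative_cong_open[OF assms(1) that, of f g]
    unfolding Ck_on_Suc differentiable_def by metis
  moreover have "Ck_on k S (dd v g)" for v
    using Suc.IH[of "dd v f" "dd v g"] dd_cong_open[OF assms(1)] Suc.prems
    by (metis Ck_on_Suc)
  ultimately show ?case by (simp add: Ck_on_Suc)
qed

lemma dd_const_fun: "dd v (\<lambda>y. c) = (\<lambda>x. 0)"
  by (rule ext) simp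

lemma Ck_on_const: "Ck_on k S (\<lambda>x. c)"
  by (induction k arbitrary: c) (simp_all add: Ck_on_Suc dd_const_fun)

lemma Ck_on_add:
  assumes "open S"
  shows "Ck_on k S f \<Longrightarrow> Ck_on k S g \<Longrightarrow> Ck_on k S (\<lambda>x. f x + g x)"
proof (induction k arbitrary: f g)
  case 0
  then show ?case using continuous_on_add[of S f g] by simp
next
  case (Suc k)
  have A: "Ck_on k S (\<lambda>x. dd v f x + dd v g x)" for v
    using Suc.prems by (intro Suc.IH Ck_on_dd)
  have "Ck_on k S (dd v (\<lambda>x. f x + g x))" for v
    by (rule Ck_on_cong_open[OF assms(1) _ A[of v]]) (use Suc.prems in \<open>simp add: dd_add Ck_on_Suc\<close>)
  then show ?case using Suc.prems by (auto simp: Ck_on_Suc)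
qed

lemma Ck_on_mult:
  assumes "open S"
  shows "Ck_on k S f \<Longrightarrow> Ck_on k S g \<Longrightarrow> Ck_on k S (\<lambda>x. f x * g x)"
proof (induction k arbitrary: f g)
  case 0
  then show ?case by (simp add: continuous_on_mult)
next
  case (Suc k)
  have A: "Ck_on k S (\<lambda>x. f x * dd v g x + g x * dd v f x)" for v
    using Suc.prems by (intro Ck_on_add Suc.IH assms Ck_on_dd Ck_on_pred[of k S f] Ck_on_pred[of k S g])
  have "Ck_on k S (dd v (\<lambda>x. f x * g x))" for v
    by (rule Ck_on_cong_open[OF assms(1) _ A[of v]]) (use Suc.prems in \<open>simp add: dd_mult Ck_on_Suc\<close>)
  then show ?case using Suc.prems by (auto simp: Ck_on_Suc)
qed

lemma Ck_on_uminus: "open S \<Longrightarrow> Ck_on k S f \<Longrightarrow> Ck_on k S (\<lambda>x. - f x)"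
  using Ck_on_mult[of S k "\<lambda>_. -1" f] by (simp add: Ck_on_const)

lemma Ck_on_diff: "open S \<Longrightarrow> Ck_on k S f \<Longrightarrow> Ck_on k S g \<Longrightarrow> Ck_on k S (\<lambda>x. f x - g x)"
  using Ck_on_add[of S k f "\<lambda>x. - g x"] by (simp add: Ck_on_uminus)

lemma Ck_on_inner: "Ck_on k S (\<lambda>x. x \<bullet> w)"
proof (cases k)
  case (Suc j)
  have "dd v (\<lambda>x. x \<bullet> w) = (\<lambda>x. v \<bullet> w)" for v
    by (rule ext) simp
  then have "Ck_on j S (dd v (\<lambda>x. x \<bullet> w))" for v
    by (simp add: Ck_on_const)
  moreover have "(\<lambda>x. x \<bullet> w) differentiable (at x)" for x
    by (rule bounded_linear_imp_differentiable[OF bounded_linear_inner_left])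
  ultimately show ?thesis by (simp add: Suc Ck_on_Suc)
qed (auto intro!: continuous_intros)

lemma Ck_on_exp:
  assumes "open S"
  shows "Ck_on k S f \<Longrightarrow> Ck_on k S (\<lambda>x. exp (f x))"
proof (induction k)
  case 0
  then show ?case by (simp add: continuous_on_exp)
next
  case (Suc k)
  have d: "f differentiable (at x)" if "x \<in> S" for x
    using Suc.prems that by (simp add: Ck_on_Suc)
  have A: "Ck_on k S (\<lambda>x. exp (f x) * dd v f x)" for v
    using Suc.prems by (intro Ck_on_mult[OF assms] Suc.IH Ck_on_dd Ck_on_pred[of k S f])
  have "Ck_on k S (dd v (\<lambda>x. exp (f x)))" for v
    by (rule Ck_on_cong_open[OF assms _ A[of v]]) (simp add: dd_chain[OF d DERIV_exp])
  moreover have "(\<lambda>x. exp (f x)) differentiable (at x)" if "x \<in> S" for x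
    using DERIV_compose_FDERIV[OF DERIV_exp has_derivative_dd[OF d[OF that]]]
    unfolding differentiable_def by blast
  ultimately show ?case by (simp add: Ck_on_Suc)
qed

lemma Ck_on_inverse:
  assumes "open S" "\<And>x. x \<in> S \<Longrightarrow> f x > 0" "Ck_on k S f"
  shows "Ck_on k S (\<lambda>x. inverse (f x))"
  using assms(3)
proof (induction k)
  case 0
  have "f x \<noteq> 0" if "x \<in> S" for x using assms(2)[OF that] by simp
  with 0 show ?case by (auto intro!: continuous_on_inverse)
next
  case (Suc k)
  have d: "f differentiable (at x)" if "x \<in> S" for x
    using Suc.prems that by (simp add: Ck_on_Suc)
  have 1: "Ck_on k S (\<lambda>x. (-1) * (inverse (f x) * inverse (f x)) * dd v f x)" for v
    using Suc.prems by (intro Ck_on_mult Ck_on_const assms(1) Ck_on_dd Suc.IH Ck_on_pred[of k S f])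
  have ne: "f x \<noteq> 0" if "x \<in> S" for x using assms(2)[OF that] by auto
  have "Ck_on k S (dd v (\<lambda>x. inverse (f x)))" for v
    by (rule Ck_on_cong_open[OF assms(1) _ 1[of v]])
       (subst dd_chain[OF d DERIV_inverse], auto simp: ne power2_eq_square)
  moreover have "(\<lambda>x. inverse (f x)) differentiable (at x)" if "x \<in> S" for x
    using d[OF that] ne[OF that] by (auto intro!: derivative_intros)
  ultimately show ?case by (simp add: Ck_on_Suc)
qed

lemma Ck_on_ln:
  assumes "open S" "\<And>x. x \<in> S \<Longrightarrow> f x > 0" "Ck_on k S f"
  shows "Ck_on k S (\<lambda>x. ln (f x))"
proof (cases k)
  case 0
  have "f x \<noteq> 0" if "x \<in> S" for x using assms(2)[OF that] by simp
  with 0 assms(3) show ?thesis by (auto intro!: continuous_on_ln)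
next
  case (Suc j)
  have d: "f differentiable (at x)" if "x \<in> S" for x
    using assms(3) that by (simp add: Suc Ck_on_Suc)
  have A: "Ck_on j S (\<lambda>x. inverse (f x) * dd v f x)" for v
    using assms(3) unfolding Suc
    by (intro Ck_on_mult Ck_on_dd Ck_on_inverse assms(1,2) Ck_on_pred[of j S f])
  have "Ck_on j S (dd v (\<lambda>x. ln (f x)))" for v
    by (rule Ck_on_cong_open[OF assms(1) _ A[of v]]) (simp add: dd_chain[OF d DERIV_ln] assms(2))
  moreover have "(\<lambda>x. ln (f x)) differentiable (at x)" if "x \<in> S" for x
    using DERIV_compose_FDERIV[OF DERIV_ln has_derivative_dd[OF d[OF that]]] assms(2)[OF that]
    unfolding differentiable_def by blast
  ultimately show ?thesis by (simp add: Suc Ck_on_Suc)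
qed

lemma has_real_derivative_along_line:
  assumes "f differentiable (at (x + t *\<^sub>R v))"
  shows "((\<lambda>t. f (x + t *\<^sub>R v)) has_real_derivative dd v f (x + t *\<^sub>R v)) (at t)"
proof -
  have "((\<lambda>t. x + t *\<^sub>R v) has_derivative (\<lambda>s. s *\<^sub>R v)) (at t)"
    by (auto intro!: derivative_eq_intros)
  from has_derivative_compose[OF this has_derivative_dd[OF assms]] show ?thesis
    by (simp add: has_field_derivative_def linear_scale[OF dd_linear[OF assms]] mult_commute_abs)
qed

lemma eventually_ball_segment:
  fixes x :: "'a::real_normed_vector"
  assumes "r > 0"
  shows "\<forall>\<^sub>F s in at_right (0::real). \<forall>\<alpha>\<in>{0..s}. \<forall>\<beta>\<in>{0..s}. x + \<alpha> *\<^sub>R v + \<beta> *\<^sub>R w \<in> ball x r"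
proof -
  define d where "d = r / (norm v + norm w + 1)"
  have d: "d > 0" and N: "norm v + norm w + 1 > 0"
    unfolding d_def using assms by (auto simp: add_nonneg_pos)
  have "x + \<alpha> *\<^sub>R v + \<beta> *\<^sub>R w \<in> ball x r"
    if s: "0 < s" "s < d" and "\<alpha> \<in> {0..s}" "\<beta> \<in> {0..s}" for s \<alpha> \<beta>
  proof -
    have "norm (\<alpha> *\<^sub>R v + \<beta> *\<^sub>R w) \<le> \<alpha> * norm v + \<beta> * norm w"
      using that by (metis (no_types) norm_triangle_ineq norm_scaleR abs_of_nonneg atLeastAtMost_iff)
    also have "\<dots> \<le> s * norm v + s * norm w"
      using that by (intro add_mono mult_right_mono) auto
    also have "\<dots> \<le> s * (norm v + norm w + 1)" using s by (simp add: algebra_simps)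
    also have "\<dots> < d * (norm v + norm w + 1)" using s N by (intro mult_strict_right_mono) auto
    also have "\<dots> = r" using N unfolding d_def by simp
    finally have "dist (x + \<alpha> *\<^sub>R v + \<beta> *\<^sub>R w) x < r" by (simp add: dist_norm)
    then show ?thesis by (simp add: dist_commute)
  qed
  then show ?thesis
    unfolding eventually_at_right_field using d by blast
qed

text \<open>The mixed second difference over a small parallelogram is an increment, in one direction, of the increment in the
  other, so the mean value theorem applies twice.\<close>

lemma second_difference_mvt:
  fixes f :: "'a::euclidean_space \<Rightarrow> real"
  assumes "Ck_on 2 S f" "0 < s"
    and in_S: "\<And>\<alpha> \<beta>. \<alpha> \<in> {0..s} \<Longrightarrow> \<beta> \<in> {0..s} \<Longrightarrow> x + \<alpha> *\<^sub>R v + \<beta> *\<^sub>R w \<in> S"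
  shows "\<exists>\<alpha>\<in>{0..s}. \<exists>\<beta>\<in>{0..s}. f (x + s *\<^sub>R v + s *\<^sub>R w) - f (x + s *\<^sub>R v) - f (x + s *\<^sub>R w) + f x
       = s\<^sup>2 * dd w (dd v f) (x + \<alpha> *\<^sub>R v + \<beta> *\<^sub>R w)"
proof -
  have df: "f differentiable (at y)" and ddf: "dd v f differentiable (at y)" if "y \<in> S" for y
    using assms(1) that by (auto simp: numeral_2_eq_2 Ck_on_Suc)
  define g where "g t = f ((x + s *\<^sub>R w) + t *\<^sub>R v) - f (x + t *\<^sub>R v)" for t
  have "\<exists>\<alpha>>0. \<alpha> < s \<and> g s - g 0 = (s - 0) * (dd v f ((x + s *\<^sub>R w) + \<alpha> *\<^sub>R v) - dd v f (x + \<alpha> *\<^sub>R v))"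
  proof (rule MVT2[OF \<open>0 < s\<close>])
    fix t assume t: "0 \<le> t" "t \<le> s"
    have "x + s *\<^sub>R w + t *\<^sub>R v \<in> S" "x + t *\<^sub>R v \<in> S"
      using in_S[of t s] in_S[of t 0] t \<open>0 < s\<close> by (simp_all add: ac_simps)
    then show "(g has_real_derivative dd v f ((x + s *\<^sub>R w) + t *\<^sub>R v) - dd v f (x + t *\<^sub>R v)) (at t)"
      unfolding g_def by (intro DERIV_diff has_real_derivative_along_line df)
  qed
  then obtain \<alpha> where \<alpha>: "0 < \<alpha>" "\<alpha> < s"
    and g: "g s - g 0 = s * (dd v f ((x + \<alpha> *\<^sub>R v) + s *\<^sub>R w) - dd v f ((x + \<alpha> *\<^sub>R v) + 0 *\<^sub>R w))"
    by (auto simp: ac_simps)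
  have "\<exists>\<beta>>0. \<beta> < s \<and> dd v f ((x + \<alpha> *\<^sub>R v) + s *\<^sub>R w) - dd v f ((x + \<alpha> *\<^sub>R v) + 0 *\<^sub>R w)
        = (s - 0) * dd w (dd v f) ((x + \<alpha> *\<^sub>R v) + \<beta> *\<^sub>R w)"
    using \<alpha> by (intro MVT2[OF \<open>0 < s\<close>] has_real_derivative_along_line ddf in_S) auto
  then obtain \<beta> where "0 < \<beta>" "\<beta> < s"
    "dd v f ((x + \<alpha> *\<^sub>R v) + s *\<^sub>R w) - dd v f ((x + \<alpha> *\<^sub>R v) + 0 *\<^sub>R w)
        = s * dd w (dd v f) (x + \<alpha> *\<^sub>R v + \<beta> *\<^sub>R w)"
    by auto
  with g have "g s - g 0 = s\<^sup>2 * dd w (dd v f) (x + \<alpha> *\<^sub>R v + \<beta> *\<^sub>R w)"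
    by (simp add: power2_eq_square)
  then show ?thesis
    using \<alpha> \<open>0 < \<beta>\<close> \<open>\<beta> < s\<close> unfolding g_def
    by (intro bexI[of _ \<alpha>] bexI[of _ \<beta>]) (auto simp: algebra_simps)
qed

text \<open>The mixed second difference is symmetric in \<open>v\<close> and \<open>w\<close>, so by \<open>second_difference_mvt\<close> each mixed
  derivative takes the same value at some points arbitrarily close to \<open>x\<close>; both are continuous.\<close>

lemma dd_commute:
  fixes f :: "'a::euclidean_space \<Rightarrow> real"
  assumes "open S" "Ck_on 2 S f" "x \<in> S"
  shows "dd v (dd w f) x = dd w (dd v f) x"
proof (rule ccontr)
  assume ne: "dd v (dd w f) x \<noteq> dd w (dd v f) x"
  define \<epsilon> where "\<epsilon> = \<bar>dd v (dd w f) x - dd w (dd v f) x\<bar> / 2"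
  have \<epsilon>: "\<epsilon> > 0" using ne by (simp add: \<epsilon>_def)
  have c: "isCont (dd a (dd b f)) x" for a b
    using assms by (auto simp: numeral_2_eq_2 Ck_on_Suc continuous_on_eq_continuous_at)
  have ev: "\<forall>\<^sub>F y in nhds x. \<bar>dd a (dd b f) y - dd a (dd b f) x\<bar> < \<epsilon>" for a b
    using tendstoD[OF c[of a b, unfolded isCont_def tendsto_at_iff_tendsto_nhds] \<epsilon>] by (simp add: dist_real_def)
  have "\<forall>\<^sub>F y in nhds x. y \<in> S" using assms by (simp add: eventually_nhds_in_open)
  from eventually_conj[OF this eventually_conj[OF ev[of v w] ev[of w v]]]
  obtain r where r: "r > 0" "\<And>y. y \<in> ball x r \<Longrightarrow> y \<in> S
     \<and> \<bar>dd v (dd w f) y - dd v (dd w f) x\<bar> < \<epsilon> \<and> \<bar>dd w (dd v f) y - dd w (dd v f) x\<bar> < \<epsilon>"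
    unfolding eventually_nhds_metric by (auto simp: dist_commute)
  from eventually_happens[OF eventually_conj[OF eventually_at_right_less eventually_ball_segment[OF r(1), of x v w]]]
  obtain s where s: "0 < s" "\<And>\<alpha> \<beta>. \<alpha> \<in> {0..s} \<Longrightarrow> \<beta> \<in> {0..s} \<Longrightarrow> x + \<alpha> *\<^sub>R v + \<beta> *\<^sub>R w \<in> ball x r"
    by auto
  obtain \<alpha> \<beta> where 1: "\<alpha> \<in> {0..s}" "\<beta> \<in> {0..s}"
    "f (x + s *\<^sub>R v + s *\<^sub>R w) - f (x + s *\<^sub>R v) - f (x + s *\<^sub>R w) + f x = s\<^sup>2 * dd w (dd v f) (x + \<alpha> *\<^sub>R v + \<beta> *\<^sub>R w)"
    using second_difference_mvt[OF assms(2) s(1), of x v w] s(2) r(2) by blast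
  have "x + \<alpha> *\<^sub>R w + \<beta> *\<^sub>R v \<in> ball x r" if "\<alpha> \<in> {0..s}" "\<beta> \<in> {0..s}" for \<alpha> \<beta>
    using s(2)[OF that(2,1)] by (simp add: ac_simps)
  then obtain \<alpha>' \<beta>' where 2: "\<alpha>' \<in> {0..s}" "\<beta>' \<in> {0..s}"
    "f (x + s *\<^sub>R w + s *\<^sub>R v) - f (x + s *\<^sub>R w) - f (x + s *\<^sub>R v) + f x = s\<^sup>2 * dd v (dd w f) (x + \<alpha>' *\<^sub>R w + \<beta>' *\<^sub>R v)"
    and b: "x + \<alpha>' *\<^sub>R w + \<beta>' *\<^sub>R v \<in> ball x r"
    using second_difference_mvt[OF assms(2) s(1), of x w v] r(2) by blast
  have eq: "x + s *\<^sub>R w + s *\<^sub>R v = x + s *\<^sub>R v + s *\<^sub>R w" by (simp add: ac_simps)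
  have "s\<^sup>2 * dd w (dd v f) (x + \<alpha> *\<^sub>R v + \<beta> *\<^sub>R w) = s\<^sup>2 * dd v (dd w f) (x + \<alpha>' *\<^sub>R w + \<beta>' *\<^sub>R v)"
    using 1(3) 2(3)[unfolded eq] by linarith
  then have "dd w (dd v f) (x + \<alpha> *\<^sub>R v + \<beta> *\<^sub>R w) = dd v (dd w f) (x + \<alpha>' *\<^sub>R w + \<beta>' *\<^sub>R v)"
    using s(1) by simp
  moreover have "\<bar>dd w (dd v f) (x + \<alpha> *\<^sub>R v + \<beta> *\<^sub>R w) - dd w (dd v f) x\<bar> < \<epsilon>"
    using r(2) s(2) 1 by blast
  moreover have "\<bar>dd v (dd w f) (x + \<alpha>' *\<^sub>R w + \<beta>' *\<^sub>R v) - dd v (dd w f) x\<bar> < \<epsilon>"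
    using r(2) b by blast
  ultimately show False unfolding \<epsilon>_def by (auto simp: abs_if split: if_splits)
qed

lemma dd_at_local_max:
  assumes "open U" "x \<in> U" "\<And>y. y \<in> U \<Longrightarrow> f y \<le> f x" "f differentiable (at x)"
  shows "dd v f x = 0"
  using differential_zero_maxmin[OF assms(2,1) has_derivative_dd[OF assms(4)]] assms(3)
  by (metis (no_types))

text \<open>If the second derivative in direction \<open>v\<close> were positive, the first derivative, which vanishes at
  the maximum, would be positive shortly after it on the line, and so would the increment of \<open>f\<close>.\<close>

lemma dd_dd_at_local_max:
  fixes f :: "'a::euclidean_space \<Rightarrow> real"
  assumes "open U" "x \<in> U" "\<And>y. y \<in> U \<Longrightarrow> f y \<le> f x" "Ck_on 2 U f"
  shows "dd v (dd v f) x \<le> 0"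
proof (rule ccontr)
  assume "\<not> ?thesis"
  then have pos: "dd v (dd v f) x > 0" by simp
  have d: "f differentiable (at y)" "dd v f differentiable (at y)" if "y \<in> U" for y
    using assms(4) that by (auto simp: numeral_2_eq_2 Ck_on_Suc)
  have "((\<lambda>t. dd v f (x + t *\<^sub>R v)) has_real_derivative dd v (dd v f) x) (at 0)"
    using has_real_derivative_along_line[of "dd v f" x 0 v] d(2) assms(2) by simp
  from DERIV_pos_inc_right[OF this pos] dd_at_local_max[OF assms(1-3) d(1)[OF assms(2)]]
  obtain \<delta> where \<delta>: "\<delta> > 0" "\<And>h. h > 0 \<Longrightarrow> h < \<delta> \<Longrightarrow> 0 < dd v f (x + h *\<^sub>R v)"
    by auto
  obtain r where r: "r > 0" "ball x r \<subseteq> U" using assms(1,2) openE by blast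
  from eventually_happens[OF eventually_conj[OF eventually_at_right_less
        eventually_conj[OF eventually_at_right_real[OF \<delta>(1)] eventually_ball_segment[OF r(1), of x v 0]]]]
  obtain s where s: "0 < s" "s < \<delta>" "\<And>\<alpha>. \<alpha> \<in> {0..s} \<Longrightarrow> x + \<alpha> *\<^sub>R v \<in> U"
    using r(2) by fastforce
  have "\<exists>\<alpha>>0. \<alpha> < s \<and> f (x + s *\<^sub>R v) - f (x + 0 *\<^sub>R v) = (s - 0) * dd v f (x + \<alpha> *\<^sub>R v)"
    by (intro MVT2[OF \<open>0 < s\<close>] has_real_derivative_along_line d s(3)) auto
  then obtain \<alpha> where "0 < \<alpha>" "\<alpha> < s" "f (x + s *\<^sub>R v) - f x = s * dd v f (x + \<alpha> *\<^sub>R v)" by auto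
  moreover have "s * dd v f (x + \<alpha> *\<^sub>R v) > 0" using \<delta>(2)[of \<alpha>] calculation s by simp
  ultimately show False using assms(3)[OF s(3)[of s]] s(1) by auto
qed

section \<open>Calculus in the gradient variable\<close>

text \<open>An orthonormal frame \<open>e\<close>, \<open>n\<close> of the plane and a function with positive definite Hessian. The plane
  is any Euclidean space that is spanned by the frame.\<close>

locale hessian_frame =
  fixes S :: "'a::euclidean_space set" and u :: "'a \<Rightarrow> real" and e n :: 'a
  assumes open_S: "open S"
    and u_C4: "Ck_on 4 S u"
    and frame: "e \<bullet> e = 1" "n \<bullet> n = 1" "e \<bullet> n = 0"
    and frame_expand: "\<And>x. (x \<bullet> e) *\<^sub>R e + (x \<bullet> n) *\<^sub>R n = x"
    and u_ee_pos: "\<And>x. x \<in> S \<Longrightarrow> 0 < dd e (dd e u) x"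
    and u_nn_pos: "\<And>x. x \<in> S \<Longrightarrow> 0 < dd n (dd n u) x"
    and det_pos: "\<And>x. x \<in> S \<Longrightarrow> 0 < dd e (dd e u) x * dd n (dd n u) x - (dd n (dd e u) x)\<^sup>2"
begin

abbreviation "uee \<equiv> dd e (dd e u)"
abbreviation "uen \<equiv> dd n (dd e u)"
abbreviation "unn \<equiv> dd n (dd n u)"

text \<open>\<open>J\<close> is the Jacobian determinant of \<open>x\<close> as a function of \<open>y = Du(x)\<close>; \<open>wee\<close>, \<open>wen\<close>, \<open>wnn\<close> are
  the entries of the inverse Hessian in the frame, that is of the Hessian of the Legendre transform,
  and \<open>h\<close> is its Laplacian.\<close>

definition J :: "'a \<Rightarrow> real" where
  "J x = inverse (uee x * unn x - uen x * uen x)"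
definition wee :: "'a \<Rightarrow> real" where "wee x = unn x * J x"
definition wen :: "'a \<Rightarrow> real" where "wen x = - (uen x * J x)"
definition wnn :: "'a \<Rightarrow> real" where "wnn x = uee x * J x"
definition h :: "'a \<Rightarrow> real" where "h x = wee x + wnn x"

text \<open>The vector fields \<open>de\<close> and \<open>dn\<close> are the partial derivatives with respect to \<open>y \<bullet> e\<close> and \<open>y \<bullet> n\<close>,
  expressed in the variable \<open>x\<close>, and \<open>lap\<close> is the Laplacian in \<open>y\<close>.\<close>

definition de :: "('a \<Rightarrow> real) \<Rightarrow> 'a \<Rightarrow> real" where
  "de \<phi> x = dd (wee x *\<^sub>R e + wen x *\<^sub>R n) \<phi> x"
definition dn :: "('a \<Rightarrow> real) \<Rightarrow> 'a \<Rightarrow> real" where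
  "dn \<phi> x = dd (wen x *\<^sub>R e + wnn x *\<^sub>R n) \<phi> x"
definition lap :: "('a \<Rightarrow> real) \<Rightarrow> 'a \<Rightarrow> real" where
  "lap \<phi> x = de (de \<phi>) x + dn (dn \<phi>) x"

lemma Ck_on_dd_dd: "Ck_on 2 S (dd v (dd w u))" and Ck_on_dd_u: "Ck_on 3 S (dd w u)"
  using u_C4 by (auto simp: eval_nat_numeral Ck_on_Suc)

lemma det_pos': "x \<in> S \<Longrightarrow> 0 < uee x * unn x - uen x * uen x"
  using det_pos[of x] by (simp add: power2_eq_square)

lemma J_pos: "x \<in> S \<Longrightarrow> 0 < J x"
  unfolding J_def using det_pos' by simp

lemma J_eq: "x \<in> S \<Longrightarrow> J x * (uee x * unn x - uen x * uen x) = 1"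
  unfolding J_def using det_pos'[of x] by simp

lemma Ck_on_J: "Ck_on 2 S J"
  unfolding J_def[abs_def]
  by (intro Ck_on_inverse Ck_on_diff Ck_on_mult Ck_on_const Ck_on_dd_dd open_S det_pos')

lemma Ck_on_wee: "Ck_on 2 S wee" and Ck_on_wen: "Ck_on 2 S wen" and Ck_on_wnn: "Ck_on 2 S wnn"
  unfolding wee_def[abs_def] wen_def[abs_def] wnn_def[abs_def]
  by (intro Ck_on_mult Ck_on_uminus Ck_on_dd_dd Ck_on_J open_S)+

lemma Ck_on_h: "Ck_on 2 S h"
  unfolding h_def[abs_def] by (intro Ck_on_add Ck_on_wee Ck_on_wnn open_S)

lemma wee_pos: "x \<in> S \<Longrightarrow> 0 < wee x" and wnn_pos: "x \<in> S \<Longrightarrow> 0 < wnn x"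
  unfolding wee_def wnn_def using J_pos u_ee_pos u_nn_pos by auto

lemma w_det: "x \<in> S \<Longrightarrow> wee x * wnn x - wen x * wen x = J x"
  unfolding wee_def wnn_def wen_def using J_eq[of x] by algebra

lemma wen_sq_le: "x \<in> S \<Longrightarrow> wen x * wen x \<le> wee x * wnn x"
  using w_det[of x] J_pos[of x] by simp

lemmas C2_diff = Ck_on_differentiable[where k=2, simplified]

lemma dd_commute_S: "Ck_on 2 S \<phi> \<Longrightarrow> x \<in> S \<Longrightarrow> dd v (dd w \<phi>) x = dd w (dd v \<phi>) x"
  using dd_commute[OF open_S] by blast

lemma third_derivatives:
  assumes "x \<in> S"
  shows "dd e uen x = dd n uee x" "dd e unn x = dd n uen x"
proof -
  have C: "Ck_on 2 S (dd w u)" "Ck_on 2 S u" for w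
    using Ck_on_mono[OF Ck_on_dd_u, of 2] Ck_on_mono[OF u_C4, of 2] by auto
  show "dd e uen x = dd n uee x"
    by (rule dd_commute_S[OF C(1) assms])
  have "dd e unn x = dd n (dd e (dd n u)) x"
    by (rule dd_commute_S[OF C(1) assms])
  also have "\<dots> = dd n uen x"
    by (rule dd_cong_open[OF open_S assms dd_commute_S[OF C(2)]])
  finally show "dd e unn x = dd n uen x" .
qed

lemma dd_J:
  assumes "x \<in> S"
  shows "dd v J x = - (J x * J x) * (uee x * dd v unn x + unn x * dd v uee x - 2 * uen x * dd v uen x)"
proof -
  note d = C2_diff[OF Ck_on_dd_dd assms]
  let ?D = "\<lambda>y. uee y * unn y - uen y * uen y"
  have dD: "?D differentiable (at x)"
    by (intro derivative_intros d)
  have "dd v J x = - (inverse (?D x) ^ Suc (Suc 0)) * dd v ?D x"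
    unfolding J_def[abs_def] using det_pos'[OF assms]
    by (intro dd_chain[OF dD DERIV_inverse]) simp
  also have "dd v ?D x = uee x * dd v unn x + unn x * dd v uee x - 2 * uen x * dd v uen x"
    using d by (simp add: dd_sub dd_mult)
  finally show ?thesis by (simp add: J_def[abs_def])
qed

lemma dd_w:
  assumes "x \<in> S"
  shows "dd v wee x = unn x * dd v J x + J x * dd v unn x"
    "dd v wen x = - (uen x * dd v J x + J x * dd v uen x)"
    "dd v wnn x = uee x * dd v J x + J x * dd v uee x"
  unfolding wee_def[abs_def] wen_def[abs_def] wnn_def[abs_def]
  using C2_diff[OF Ck_on_dd_dd assms] C2_diff[OF Ck_on_J assms]
  by (simp_all add: dd_mult dd_uminus)

lemma de_expand: "\<phi> differentiable (at x) \<Longrightarrow> de \<phi> x = wee x * dd e \<phi> x + wen x * dd n \<phi> x"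
  and dn_expand: "\<phi> differentiable (at x) \<Longrightarrow> dn \<phi> x = wen x * dd e \<phi> x + wnn x * dd n \<phi> x"
  unfolding de_def dn_def by (simp_all add: dd_comb)

text \<open>The third derivatives of the Legendre transform are symmetric. In the variable \<open>x\<close> this comes from
  the symmetry of the third derivatives of \<open>u\<close> by differentiating the formula for the inverse matrix.\<close>

lemma w_third_symmetric:
  assumes "x \<in> S"
  shows "de wen x = dn wee x" "de wnn x = dn wen x"
proof -
  note d = C2_diff[OF Ck_on_wee assms] C2_diff[OF Ck_on_wen assms] C2_diff[OF Ck_on_wnn assms]
  note J = J_eq[OF assms]
  show "de wen x = dn wee x"
    unfolding de_expand[OF d(1)] dn_expand[OF d(1)] de_expand[OF d(2)] dn_expand[OF d(2)]
       dd_w[OF assms] dd_J[OF assms] third_derivatives[OF assms]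
    unfolding wee_def wen_def wnn_def using J by algebra
  show "de wnn x = dn wen x"
    unfolding de_expand[OF d(2)] dn_expand[OF d(2)] de_expand[OF d(3)] dn_expand[OF d(3)]
       dd_w[OF assms] dd_J[OF assms] third_derivatives[OF assms]
    unfolding wee_def wen_def wnn_def using J by algebra
qed

lemma Ck_on_de: "Ck_on (Suc k) S \<phi> \<Longrightarrow> k \<le> 2 \<Longrightarrow> Ck_on k S (de \<phi>)"
  and Ck_on_dn: "Ck_on (Suc k) S \<phi> \<Longrightarrow> k \<le> 2 \<Longrightarrow> Ck_on k S (dn \<phi>)"
proof -
  assume \<phi>: "Ck_on (Suc k) S \<phi>" and k: "k \<le> 2"
  have A: "Ck_on k S (\<lambda>x. wee x * dd e \<phi> x + wen x * dd n \<phi> x)"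
    and B: "Ck_on k S (\<lambda>x. wen x * dd e \<phi> x + wnn x * dd n \<phi> x)"
    using \<phi> k by (auto intro!: Ck_on_add Ck_on_mult open_S Ck_on_dd
        intro: Ck_on_mono[OF Ck_on_wee] Ck_on_mono[OF Ck_on_wen] Ck_on_mono[OF Ck_on_wnn])
  show "Ck_on k S (de \<phi>)"
    by (rule Ck_on_cong_open[OF open_S _ A]) (simp add: de_expand Ck_on_differentiable[OF \<phi>])
  show "Ck_on k S (dn \<phi>)"
    by (rule Ck_on_cong_open[OF open_S _ B]) (simp add: dn_expand Ck_on_differentiable[OF \<phi>])
qed

lemma de_diff: "Ck_on 2 S \<phi> \<Longrightarrow> x \<in> S \<Longrightarrow> de \<phi> differentiable (at x)"
  and dn_diff: "Ck_on 2 S \<phi> \<Longrightarrow> x \<in> S \<Longrightarrow> dn \<phi> differentiable (at x)"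
  using Ck_on_de[of 1 \<phi>] Ck_on_dn[of 1 \<phi>] Ck_on_differentiable[of 1 S]
  by (auto simp: numeral_2_eq_2)

lemma de_cong: "x \<in> S \<Longrightarrow> (\<And>y. y \<in> S \<Longrightarrow> \<phi> y = \<psi> y) \<Longrightarrow> de \<phi> x = de \<psi> x"
  and dn_cong: "x \<in> S \<Longrightarrow> (\<And>y. y \<in> S \<Longrightarrow> \<phi> y = \<psi> y) \<Longrightarrow> dn \<phi> x = dn \<psi> x"
  unfolding de_def dn_def using dd_cong_open[OF open_S] by blast+

lemma dd_diff: "Ck_on 2 S \<phi> \<Longrightarrow> x \<in> S \<Longrightarrow> dd v \<phi> differentiable (at x)"
  by (simp add: numeral_2_eq_2 Ck_on_Suc)

lemma dd_de:
  assumes "Ck_on 2 S \<phi>" "x \<in> S"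
  shows "dd v (de \<phi>) x = dd v wee x * dd e \<phi> x + wee x * dd v (dd e \<phi>) x
      + dd v wen x * dd n \<phi> x + wen x * dd v (dd n \<phi>) x"
    and "dd v (dn \<phi>) x = dd v wen x * dd e \<phi> x + wen x * dd v (dd e \<phi>) x
      + dd v wnn x * dd n \<phi> x + wnn x * dd v (dd n \<phi>) x"
proof -
  note d = C2_diff[OF Ck_on_wee assms(2)] C2_diff[OF Ck_on_wen assms(2)] C2_diff[OF Ck_on_wnn assms(2)]
    dd_diff[OF assms]
  have "dd v (de \<phi>) x = dd v (\<lambda>x. wee x * dd e \<phi> x + wen x * dd n \<phi> x) x"
    using assms(1) by (intro dd_cong_open[OF open_S assms(2)] de_expand C2_diff)
  then show "dd v (de \<phi>) x = dd v wee x * dd e \<phi> x + wee x * dd v (dd e \<phi>) x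
      + dd v wen x * dd n \<phi> x + wen x * dd v (dd n \<phi>) x"
    using d by (simp add: dd_add dd_mult)
  have "dd v (dn \<phi>) x = dd v (\<lambda>x. wen x * dd e \<phi> x + wnn x * dd n \<phi> x) x"
    using assms(1) by (intro dd_cong_open[OF open_S assms(2)] dn_expand C2_diff)
  then show "dd v (dn \<phi>) x = dd v wen x * dd e \<phi> x + wen x * dd v (dd e \<phi>) x
      + dd v wnn x * dd n \<phi> x + wnn x * dd v (dd n \<phi>) x"
    using d by (simp add: dd_add dd_mult)
qed

text \<open>The commutator is a first-order operator whose coefficients are the differences that vanish by
  \<open>w_third_symmetric\<close>: \<open>de\<close> and \<open>dn\<close> are coordinate derivatives.\<close>

lemma de_dn_commute:
  assumes "Ck_on 2 S \<phi>" "x \<in> S"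
  shows "de (dn \<phi>) x = dn (de \<phi>) x"
proof -
  note d = C2_diff[OF Ck_on_wee assms(2)] C2_diff[OF Ck_on_wen assms(2)] C2_diff[OF Ck_on_wnn assms(2)]
  have c: "dd e (dd n \<phi>) x = dd n (dd e \<phi>) x" by (rule dd_commute_S[OF assms])
  have "wee x * dd e wen x + wen x * dd n wen x = wen x * dd e wee x + wnn x * dd n wee x"
    "wee x * dd e wnn x + wen x * dd n wnn x = wen x * dd e wen x + wnn x * dd n wen x"
    using w_third_symmetric[OF assms(2)] d by (simp_all add: de_expand dn_expand)
  then have "(wee x * dd e wen x + wen x * dd n wen x) * dd e \<phi> x = (wen x * dd e wee x + wnn x * dd n wee x) * dd e \<phi> x"
    "(wee x * dd e wnn x + wen x * dd n wnn x) * dd n \<phi> x = (wen x * dd e wen x + wnn x * dd n wen x) * dd n \<phi> x"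
    by simp_all
  then show ?thesis
    unfolding de_expand[OF dn_diff[OF assms]] dn_expand[OF de_diff[OF assms]] dd_de[OF assms] c
    by (simp add: algebra_simps)
qed

text \<open>Freezing the coefficients of \<open>de\<close> at \<open>x\<close> splits its square into a pure second derivative
  along the fixed vector \<open>\<xi>\<close> and first-order terms.\<close>

lemma de_de_eq:
  assumes "Ck_on 2 S \<phi>" "x \<in> S" and \<xi>: "\<xi> = wee x *\<^sub>R e + wen x *\<^sub>R n"
  shows "de (de \<phi>) x = dd \<xi> (dd \<xi> \<phi>) x + de wee x * dd e \<phi> x + de wen x * dd n \<phi> x"
proof -
  have "dd \<xi> (dd \<xi> \<phi>) x = dd \<xi> (\<lambda>y. wee x * dd e \<phi> y + wen x * dd n \<phi> y) x"
    unfolding \<xi> using assms(1) by (intro dd_cong_open[OF open_S assms(2)] dd_comb C2_diff)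
  also have "\<dots> = wee x * dd \<xi> (dd e \<phi>) x + wen x * dd \<xi> (dd n \<phi>) x"
    using dd_diff[OF assms(1,2)] by (simp add: dd_add dd_mult)
  finally show ?thesis
    using dd_de(1)[OF assms(1,2), of \<xi>] unfolding de_def[of _ x] \<xi>[symmetric] by simp
qed

lemma dn_dn_eq:
  assumes "Ck_on 2 S \<phi>" "x \<in> S" and \<xi>: "\<xi> = wen x *\<^sub>R e + wnn x *\<^sub>R n"
  shows "dn (dn \<phi>) x = dd \<xi> (dd \<xi> \<phi>) x + dn wen x * dd e \<phi> x + dn wnn x * dd n \<phi> x"
proof -
  have "dd \<xi> (dd \<xi> \<phi>) x = dd \<xi> (\<lambda>y. wen x * dd e \<phi> y + wnn x * dd n \<phi> y) x"
    unfolding \<xi> using assms(1) by (intro dd_cong_open[OF open_S assms(2)] dd_comb C2_diff)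
  also have "\<dots> = wen x * dd \<xi> (dd e \<phi>) x + wnn x * dd \<xi> (dd n \<phi>) x"
    using dd_diff[OF assms(1,2)] by (simp add: dd_add dd_mult)
  finally show ?thesis
    using dd_de(2)[OF assms(1,2), of \<xi>] unfolding dn_def[of _ x] \<xi>[symmetric] by simp
qed

text \<open>At a maximum the first-order terms of \<open>lap\<close> vanish, and what remains are second derivatives along
  two fixed vectors.\<close>

lemma lap_nonpos_at_max:
  assumes "Ck_on 2 S \<phi>" "open U" "U \<subseteq> S" "x \<in> U" "\<And>y. y \<in> U \<Longrightarrow> \<phi> y \<le> \<phi> x"
  shows "lap \<phi> x \<le> 0"
proof -
  have x: "x \<in> S" using assms by auto
  have "Ck_on 2 U \<phi>"
    using Ck_on_subset assms(1,3) by blast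
  then have "dd \<xi> (dd \<xi> \<phi>) x \<le> 0" for \<xi>
    using dd_dd_at_local_max[of U x \<phi>] assms(2,4,5) by blast
  moreover have "dd \<xi> \<phi> x = 0" for \<xi>
    using dd_at_local_max[of U x \<phi>] assms(2,4,5) C2_diff[OF assms(1) x] by blast
  ultimately show ?thesis
    unfolding lap_def by (simp add: de_de_eq[OF assms(1) x refl] dn_dn_eq[OF assms(1) x refl] add_nonpos_nonpos)
qed

lemma de_add: "\<phi> differentiable (at x) \<Longrightarrow> \<psi> differentiable (at x) \<Longrightarrow> de (\<lambda>y. \<phi> y + \<psi> y) x = de \<phi> x + de \<psi> x"
  and dn_add: "\<phi> differentiable (at x) \<Longrightarrow> \<psi> differentiable (at x) \<Longrightarrow> dn (\<lambda>y. \<phi> y + \<psi> y) x = dn \<phi> x + dn \<psi> x"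
  and de_mult: "\<phi> differentiable (at x) \<Longrightarrow> \<psi> differentiable (at x) \<Longrightarrow> de (\<lambda>y. \<phi> y * \<psi> y) x = \<phi> x * de \<psi> x + \<psi> x * de \<phi> x"
  and dn_mult: "\<phi> differentiable (at x) \<Longrightarrow> \<psi> differentiable (at x) \<Longrightarrow> dn (\<lambda>y. \<phi> y * \<psi> y) x = \<phi> x * dn \<psi> x + \<psi> x * dn \<phi> x"
  and de_const: "de (\<lambda>y. c) x = 0"
  and dn_const: "dn (\<lambda>y. c) x = 0"
  and de_chain: "\<phi> differentiable (at x) \<Longrightarrow> (g has_real_derivative g') (at (\<phi> x)) \<Longrightarrow> de (\<lambda>y. g (\<phi> y)) x = g' * de \<phi> x"
  and dn_chain: "\<phi> differentiable (at x) \<Longrightarrow> (g has_real_derivative g') (at (\<phi> x)) \<Longrightarrow> dn (\<lambda>y. g (\<phi> y)) x = g' * dn \<phi> x"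
  unfolding de_def dn_def by (simp_all add: dd_add dd_mult dd_chain)

lemma lap_add:
  assumes "Ck_on 2 S \<phi>" "Ck_on 2 S \<psi>" "x \<in> S"
  shows "lap (\<lambda>y. \<phi> y + \<psi> y) x = lap \<phi> x + lap \<psi> x"
proof -
  note d = C2_diff[OF assms(1)] C2_diff[OF assms(2)]
  have "de (de (\<lambda>y. \<phi> y + \<psi> y)) x = de (\<lambda>y. de \<phi> y + de \<psi> y) x"
    "dn (dn (\<lambda>y. \<phi> y + \<psi> y)) x = dn (\<lambda>y. dn \<phi> y + dn \<psi> y) x"
    using d by (auto intro!: de_cong dn_cong simp: de_add dn_add assms)
  then show ?thesis
    using assms by (simp add: lap_def de_add dn_add de_diff dn_diff)
qed

lemma lap_mult:
  assumes "Ck_on 2 S \<phi>" "Ck_on 2 S \<psi>" "x \<in> S"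
  shows "lap (\<lambda>y. \<phi> y * \<psi> y) x = \<phi> x * lap \<psi> x + \<psi> x * lap \<phi> x + 2 * (de \<phi> x * de \<psi> x + dn \<phi> x * dn \<psi> x)"
proof -
  note d = C2_diff[OF assms(1)] C2_diff[OF assms(2)]
  have "de (de (\<lambda>y. \<phi> y * \<psi> y)) x = de (\<lambda>y. \<phi> y * de \<psi> y + \<psi> y * de \<phi> y) x"
    "dn (dn (\<lambda>y. \<phi> y * \<psi> y)) x = dn (\<lambda>y. \<phi> y * dn \<psi> y + \<psi> y * dn \<phi> y) x"
    using d by (auto intro!: de_cong dn_cong simp: de_mult dn_mult assms)
  then show ?thesis
    using assms d[OF assms(3)]
    by (simp add: lap_def de_add dn_add de_diff dn_diff de_mult dn_mult algebra_simps)
qed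

lemma lap_const: "lap (\<lambda>y. c) x = 0"
proof -
  have "de (\<lambda>y. c) = (\<lambda>_. 0)" "dn (\<lambda>y. c) = (\<lambda>_. 0)" for c by (auto simp: de_const dn_const)
  then show ?thesis by (simp add: lap_def)
qed

lemma lap_cmult: "Ck_on 2 S \<phi> \<Longrightarrow> x \<in> S \<Longrightarrow> lap (\<lambda>y. c * \<phi> y) x = c * lap \<phi> x"
  by (simp add: lap_mult Ck_on_const lap_const de_const dn_const)

lemma lap_exp:
  assumes "Ck_on 2 S \<phi>" "x \<in> S"
  shows "lap (\<lambda>y. exp (\<phi> y)) x = exp (\<phi> x) * (lap \<phi> x + (de \<phi> x)\<^sup>2 + (dn \<phi> x)\<^sup>2)"
proof -
  note d = C2_diff[OF assms(1)]
  have c: "de (\<lambda>y. exp (\<phi> y)) y = exp (\<phi> y) * de \<phi> y" "dn (\<lambda>y. exp (\<phi> y)) y = exp (\<phi> y) * dn \<phi> y"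
    if "y \<in> S" for y
    using d[OF that] by (auto intro!: de_chain dn_chain DERIV_exp)
  have E: "(\<lambda>y. exp (\<phi> y)) differentiable (at x)"
    using Ck_on_exp[OF open_S assms(1)] assms(2) C2_diff by blast
  have "de (de (\<lambda>y. exp (\<phi> y))) x = de (\<lambda>y. exp (\<phi> y) * de \<phi> y) x"
    "dn (dn (\<lambda>y. exp (\<phi> y))) x = dn (\<lambda>y. exp (\<phi> y) * dn \<phi> y) x"
    by (intro de_cong dn_cong assms(2) c; assumption)+
  then show ?thesis
    using assms E
    by (simp add: lap_def de_diff dn_diff de_mult dn_mult c algebra_simps power2_eq_square)
qed

text \<open>Multiplied out, so that it reads as a formula for the Laplacian of a positive function in terms of its
  logarithm; obtained by applying \<open>lap_exp\<close> to the logarithm.\<close>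

lemma lap_ln:
  assumes "Ck_on 2 S \<phi>" "x \<in> S" "\<And>y. y \<in> S \<Longrightarrow> 0 < \<phi> y"
  shows "\<phi> x * lap (\<lambda>y. ln (\<phi> y)) x = lap \<phi> x - \<phi> x * ((de (\<lambda>y. ln (\<phi> y)) x)\<^sup>2 + (dn (\<lambda>y. ln (\<phi> y)) x)\<^sup>2)"
proof -
  have "lap \<phi> x = lap (\<lambda>y. exp (ln (\<phi> y))) x"
    unfolding lap_def using assms(2,3)
    by (auto intro!: arg_cong2[where f="(+)"] de_cong dn_cong)
  then show ?thesis
    using lap_exp[OF Ck_on_ln[OF open_S assms(3,1)] assms(2)] assms(2,3) by (simp add: algebra_simps)
qed

lemma de_ln: 
  assumes "Ck_on 2 S \<phi>" "x \<in> S" "\<And>y. y \<in> S \<Longrightarrow> 0 < \<phi> y"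
  shows "de \<phi> x = \<phi> x * de (\<lambda>y. ln (\<phi> y)) x" "dn \<phi> x = \<phi> x * dn (\<lambda>y. ln (\<phi> y)) x"
proof -
  have "\<phi> x > 0" using assms by blast
  then show "de \<phi> x = \<phi> x * de (\<lambda>y. ln (\<phi> y)) x" "dn \<phi> x = \<phi> x * dn (\<lambda>y. ln (\<phi> y)) x"
    by (simp_all add: de_chain[OF C2_diff[OF assms(1,2)] DERIV_ln] dn_chain[OF C2_diff[OF assms(1,2)] DERIV_ln])
qed

lemma de_coord: "de (\<lambda>y. y \<bullet> e) x = wee x" "de (\<lambda>y. y \<bullet> n) x = wen x"
  and dn_coord: "dn (\<lambda>y. y \<bullet> e) x = wen x" "dn (\<lambda>y. y \<bullet> n) x = wnn x"
  unfolding de_def dn_def using frame by (simp_all add: inner_simps inner_commute[of n e])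

lemma de_h: "x \<in> S \<Longrightarrow> de h x = de wee x + de wnn x" and dn_h: "x \<in> S \<Longrightarrow> dn h x = dn wee x + dn wnn x"
  unfolding h_def[abs_def] using C2_diff[OF Ck_on_wee] C2_diff[OF Ck_on_wnn]
  by (simp_all add: de_add dn_add)

text \<open>The position \<open>x\<close> is the gradient of the Legendre transform, so its Laplacian is the gradient of the
  trace \<open>h\<close>.\<close>

lemma lap_coord:
  assumes "x \<in> S"
  shows "lap (\<lambda>y. y \<bullet> e) x = de h x" "lap (\<lambda>y. y \<bullet> n) x = dn h x"
proof -
  have "de (\<lambda>y. y \<bullet> e) = wee" "de (\<lambda>y. y \<bullet> n) = wen" "dn (\<lambda>y. y \<bullet> e) = wen" "dn (\<lambda>y. y \<bullet> n) = wnn"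
    by (auto simp: de_coord dn_coord)
  then show "lap (\<lambda>y. y \<bullet> e) x = de h x" "lap (\<lambda>y. y \<bullet> n) x = dn h x"
    using assms by (simp_all add: lap_def de_h dn_h w_third_symmetric)
qed

lemma gradient_coord:
  assumes "x \<in> S"
  shows "de (dd e u) x = 1" "dn (dd e u) x = 0" "de (dd n u) x = 0" "dn (dd n u) x = 1"
proof -
  have d: "dd v u differentiable (at x)" for v
    using Ck_on_differentiable[OF Ck_on_dd_u _ assms] by simp
  have s: "dd e (dd n u) x = uen x"
    using dd_commute_S[OF Ck_on_mono[OF u_C4] assms] by simp
  show "de (dd e u) x = 1" "dn (dd e u) x = 0" "de (dd n u) x = 0" "dn (dd n u) x = 1"
    unfolding de_expand[OF d] dn_expand[OF d] s wee_def wen_def wnn_def using J_eq[OF assms] by algebra+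
qed

lemma lap_gradient_coord:
  assumes "x \<in> S"
  shows "lap (dd e u) x = 0" "lap (dd n u) x = 0"
proof -
  have "de (de (dd e u)) x = de (\<lambda>_. 1) x" "dn (dn (dd e u)) x = dn (\<lambda>_. 0) x"
    "de (de (dd n u)) x = de (\<lambda>_. 0) x" "dn (dn (dd n u)) x = dn (\<lambda>_. 1) x"
    by (intro de_cong dn_cong assms gradient_coord; assumption)+
  then show "lap (dd e u) x = 0" "lap (dd n u) x = 0"
    by (simp_all add: lap_def de_const dn_const)
qed

text \<open>The Laplacian of the second derivative \<open>wee\<close> of the Legendre transform is the second derivative of its
  Laplacian \<open>h\<close>. Writing the latter by \<open>de_de_eq\<close> and using the symmetry of third derivatives turns
  the terms of first order in \<open>h\<close> into derivatives of \<open>wee\<close>.\<close>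

lemma lap_wee:
  assumes "x \<in> S" and \<xi>: "\<xi> = wee x *\<^sub>R e + wen x *\<^sub>R n"
  shows "lap wee x = dd \<xi> (dd \<xi> h) x + dd e h x * de wee x + dd n h x * dn wee x"
proof -
  have "dn (dn wee) x = dn (de wen) x"
    by (rule dn_cong[OF assms(1)]) (simp add: w_third_symmetric)
  also have "\<dots> = de (dn wen) x"
    by (rule de_dn_commute[OF Ck_on_wen assms(1), symmetric])
  also have "\<dots> = de (de wnn) x"
    by (rule de_cong[OF assms(1)]) (simp add: w_third_symmetric)
  finally have "lap wee x = de (\<lambda>y. de wee y + de wnn y) x"
    using de_diff[OF Ck_on_wee assms(1)] de_diff[OF Ck_on_wnn assms(1)] by (simp add: lap_def de_add)
  also have "\<dots> = de (de h) x"
    by (rule de_cong[OF assms(1)]) (simp add: de_h)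
  finally show ?thesis
    unfolding de_de_eq[OF Ck_on_h assms] w_third_symmetric[OF assms(1)] by (simp add: mult.commute)
qed

end

section \<open>The maximum principle argument\<close>

text \<open>The constants of the barrier argument: the exponent \<open>p\<close> of \<open>wee\<close>, the rate \<open>k\<close> of the exponential in
  \<open>A\<close>, the bound \<open>Q\<close> of that exponential, the weight \<open>N\<close> of the supersolution, and
  the resulting lower bound for \<open>wee\<close> at the origin. The number \<open>(2 B + 2)\<^sup>2\<close> in
  \<open>p\<close> comes from completing squares in \<open>lap_G_le\<close>, and \<open>k\<close> is the coefficient of the mixed term in \<open>lap_A_ge\<close>.
  All depend only on the bounds \<open>H\<close>, \<open>B\<close>, \<open>R\<close>
  of the locale below.\<close>

definition p_const :: "real \<Rightarrow> real \<Rightarrow> real" where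
  "p_const B R = 1 / (R\<^sup>2 * (2 * B + 4 * (B + 1)\<^sup>2))"
definition k_const :: "real \<Rightarrow> real \<Rightarrow> real" where
  "k_const H B = 12 * H + 4 * B"
definition Q_const :: "real \<Rightarrow> real \<Rightarrow> real \<Rightarrow> real" where
  "Q_const H B R = exp (k_const H B * R)"
definition N_const :: "real \<Rightarrow> real \<Rightarrow> real \<Rightarrow> real" where
  "N_const H B R = Q_const H B R * H * (8 * k_const H B + 2 * B + 2 * H) + 1"
definition c_const :: "real \<Rightarrow> real \<Rightarrow> real \<Rightarrow> real" where
  "c_const H B R = exp (- ln (2 * Q_const H B R * N_const H B R * R\<^sup>2) / p_const B R)"

lemma c_const_pos: "0 < c_const H B R" by (simp add: c_const_def)

lemma mult_le_mult_abs:
  fixes a b c :: real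
  assumes "\<bar>a\<bar> \<le> b"
  shows "a * c \<le> b * \<bar>c\<bar>" "- (a * c) \<le> b * \<bar>c\<bar>"
proof -
  have "\<bar>a * c\<bar> \<le> b * \<bar>c\<bar>" using assms by (simp add: abs_mult mult_right_mono)
  then show "a * c \<le> b * \<bar>c\<bar>" "- (a * c) \<le> b * \<bar>c\<bar>" by linarith+
qed

text \<open>The quantitative information needed from the equation. The essential point is that the second
  derivative of \<open>h\<close> along the vector \<open>\<xi>\<close>, the first row of the inverse Hessian, is controlled by \<open>wee\<close> itself.\<close>

locale bounded_hessian_frame = hessian_frame +
  fixes H B R :: real
  assumes H_ge: "1 \<le> H" and B_nonneg: "0 \<le> B" and R_ge: "1 \<le> R"
    and unit_ball: "cball 0 1 \<subseteq> S"
    and h_le: "\<And>x. x \<in> S \<Longrightarrow> h x \<le> H"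
    and dd_h_le: "\<And>x v. x \<in> S \<Longrightarrow> \<bar>dd v h x\<bar> \<le> B * norm v"
    and dd_dd_h_le: "\<And>x \<xi>. x \<in> S \<Longrightarrow> \<xi> = wee x *\<^sub>R e + wen x *\<^sub>R n \<Longrightarrow> dd \<xi> (dd \<xi> h) x \<le> B * wee x"
    and gradient_le: "\<And>x. x \<in> S \<Longrightarrow> (dd e u x)\<^sup>2 + (dd n u x)\<^sup>2 \<le> R\<^sup>2"
begin

lemma norm_frame: "(norm (s *\<^sub>R e + t *\<^sub>R n))\<^sup>2 = s\<^sup>2 + t\<^sup>2"
  unfolding power2_norm_eq_inner using frame
  by (simp add: inner_simps inner_commute[of n e] power2_eq_square)

lemma norm_sq_coord: "(norm x)\<^sup>2 = (x \<bullet> e)\<^sup>2 + (x \<bullet> n)\<^sup>2"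
  using norm_frame[of "x \<bullet> e" "x \<bullet> n"] by (simp add: frame_expand)

lemma norm_e: "norm e = 1" and norm_n: "norm n = 1"
  using frame by (simp_all add: norm_eq_1)

text \<open>By positivity of the inverse Hessian \<open>W\<close>, the squared length of \<open>We\<close> is at most the trace
  times \<open>We \<bullet> e\<close>: if \<open>wee\<close> is small, so is the whole first row.\<close>

lemma w_bounds:
  assumes "x \<in> S"
  shows "wee x \<le> H" "wee x * wee x + wen x * wen x \<le> H * wee x"
    "wen x * wen x + wnn x * wnn x \<le> H * H"
proof -
  note pos = wee_pos[OF assms] wnn_pos[OF assms]
  have H: "wee x + wnn x \<le> H" using h_le[OF assms] by (simp add: h_def)
  then show "wee x \<le> H" using pos by simp
  have "wee x * wee x + wen x * wen x \<le> (wee x + wnn x) * wee x"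
    using wen_sq_le[OF assms] by (simp add: algebra_simps)
  also have "\<dots> \<le> H * wee x" using H pos by (intro mult_right_mono) auto
  finally show "wee x * wee x + wen x * wen x \<le> H * wee x" .
  have "wen x * wen x + wnn x * wnn x \<le> (wee x + wnn x) * wnn x"
    using wen_sq_le[OF assms] by (simp add: algebra_simps)
  also have "\<dots> \<le> H * H" using H pos by (intro mult_mono) auto
  finally show "wen x * wen x + wnn x * wnn x \<le> H * H" .
qed

abbreviation "p \<equiv> p_const B R"
abbreviation "k \<equiv> k_const H B"
abbreviation "Q \<equiv> Q_const H B R"
abbreviation "N \<equiv> N_const H B R"

lemma p_bounds: "0 < p" "p \<le> 1/4" "p * (R\<^sup>2 * (2 * B + 4 * (B + 1)\<^sup>2)) = 1"
proof -
  have "4 * 1 \<le> 2 * B + 4 * (B + 1)\<^sup>2"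
    using B_nonneg by (simp add: power2_eq_square algebra_simps)
  moreover have R: "1 \<le> R\<^sup>2" using R_ge by simp
  ultimately have "1 * 4 \<le> R\<^sup>2 * (2 * B + 4 * (B + 1)\<^sup>2)" by (intro mult_mono) auto
  then show "0 < p" "p \<le> 1/4" "p * (R\<^sup>2 * (2 * B + 4 * (B + 1)\<^sup>2)) = 1"
    unfolding p_const_def by (auto simp: field_simps)
qed

lemma k_pos: "0 < k" using H_ge B_nonneg by (simp add: k_const_def)

lemma Q_ge: "1 \<le> Q" using k_pos R_ge by (simp add: Q_const_def)

lemma N_ge: "1 \<le> N" using Q_ge H_ge B_nonneg k_pos by (simp add: N_const_def)

text \<open>\<open>g\<close> is the power \<open>p\<close> of \<open>wee\<close>, and \<open>zeta\<close> is a positive bounded function with constant negative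
  Laplacian in \<open>y = Du\<close>; the bound \<open>R\<close> of the gradient keeps it away from \<open>0\<close>.\<close>

definition lw :: "'a \<Rightarrow> real" where "lw x = ln (wee x)"
definition g :: "'a \<Rightarrow> real" where "g x = exp (p * lw x)"
definition zeta :: "'a \<Rightarrow> real" where
  "zeta x = 2 * R\<^sup>2 - 1/2 * (dd e u x * dd e u x + dd n u x * dd n u x)"

lemma Ck_on_lw: "Ck_on 2 S lw"
  unfolding lw_def[abs_def] by (intro Ck_on_ln Ck_on_wee open_S wee_pos)

lemma Ck_on_g: "Ck_on 2 S g"
  unfolding g_def[abs_def] by (intro Ck_on_exp Ck_on_mult Ck_on_const Ck_on_lw open_S)

lemma Ck2_dd_u: "Ck_on 2 S (dd v u)"
  using Ck_on_mono[OF Ck_on_dd_u] by simp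

lemma Ck_on_zeta: "Ck_on 2 S zeta"
  unfolding zeta_def[abs_def]
  by (intro Ck_on_diff Ck_on_mult Ck_on_add Ck_on_const open_S Ck2_dd_u)

text \<open>For the logarithm the quadratic gradient term has the good sign, and it will absorb the linear one.\<close>

lemma lap_lw_le:
  assumes "x \<in> S"
  shows "lap lw x \<le> B + B * (\<bar>de lw x\<bar> + \<bar>dn lw x\<bar>) - ((de lw x)\<^sup>2 + (dn lw x)\<^sup>2)"
proof -
  let ?a = "de lw x" and ?b = "dn lw x"
  note w = wee_pos[OF assms]
  have D: "de wee x = wee x * ?a" "dn wee x = wee x * ?b"
    unfolding lw_def[abs_def] using de_ln[OF Ck_on_wee assms wee_pos] by auto
  have "\<bar>dd e h x\<bar> \<le> B" "\<bar>dd n h x\<bar> \<le> B"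
    using dd_h_le[OF assms, of e] dd_h_le[OF assms, of n] by (simp_all add: norm_e norm_n)
  then have "dd e h x * ?a \<le> B * \<bar>?a\<bar>" "dd n h x * ?b \<le> B * \<bar>?b\<bar>"
    by (auto intro: mult_le_mult_abs)
  then have "dd e h x * ?a + dd n h x * ?b \<le> B * (\<bar>?a\<bar> + \<bar>?b\<bar>)" by (simp add: algebra_simps)
  then have 1: "wee x * (dd e h x * ?a + dd n h x * ?b) \<le> wee x * (B * (\<bar>?a\<bar> + \<bar>?b\<bar>))"
    using w by (intro mult_left_mono) auto
  have "lap wee x \<le> B * wee x + dd e h x * de wee x + dd n h x * dn wee x"
    using lap_wee[OF assms refl] dd_dd_h_le[OF assms refl] by simp
  also have "\<dots> = B * wee x + wee x * (dd e h x * ?a + dd n h x * ?b)"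
    unfolding D by (simp add: algebra_simps)
  also have "\<dots> \<le> wee x * (B + B * (\<bar>?a\<bar> + \<bar>?b\<bar>))"
    using 1 by (simp add: algebra_simps)
  finally have "wee x * lap lw x \<le> wee x * (B + B * (\<bar>?a\<bar> + \<bar>?b\<bar>) - (?a\<^sup>2 + ?b\<^sup>2))"
    using lap_ln[OF Ck_on_wee assms wee_pos] unfolding lw_def[abs_def] by (simp add: algebra_simps)
  then show ?thesis using w by simp
qed

lemma zeta_bounds:
  assumes "x \<in> S" shows "R\<^sup>2 \<le> zeta x" "zeta x \<le> 2 * R\<^sup>2"
proof -
  define y where "y = dd e u x * dd e u x + dd n u x * dd n u x"
  have "y \<le> R\<^sup>2" using gradient_le[OF assms] by (simp add: y_def power2_eq_square)
  moreover have "0 \<le> y" "0 \<le> R\<^sup>2" by (simp_all add: y_def)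
  moreover have "zeta x = 2 * R\<^sup>2 - 1/2 * y" by (simp add: zeta_def y_def)
  ultimately show "R\<^sup>2 \<le> zeta x" "zeta x \<le> 2 * R\<^sup>2" by linarith+
qed

lemma zeta_derivatives:
  assumes "x \<in> S"
  shows "de zeta x = - dd e u x" "dn zeta x = - dd n u x" "lap zeta x = - 2"
proof -
  have z: "zeta = (\<lambda>x. 2 * R\<^sup>2 + (-1/2) * (dd e u x * dd e u x + dd n u x * dd n u x))"
    by (auto simp: zeta_def)
  note C = Ck2_dd_u Ck_on_mult[OF open_S Ck2_dd_u Ck2_dd_u] Ck_on_add[OF open_S Ck_on_mult[OF open_S Ck2_dd_u Ck2_dd_u] Ck_on_mult[OF open_S Ck2_dd_u Ck2_dd_u]]
    Ck_on_mult[OF open_S Ck_on_const Ck_on_add[OF open_S Ck_on_mult[OF open_S Ck2_dd_u Ck2_dd_u] Ck_on_mult[OF open_S Ck2_dd_u Ck2_dd_u]]] Ck_on_const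
  note d = C[THEN C2_diff, OF assms]
  show "de zeta x = - dd e u x" "dn zeta x = - dd n u x"
    unfolding z
    by (simp_all only: de_add dn_add de_mult dn_mult de_const dn_const gradient_coord[OF assms] d) simp_all
  show "lap zeta x = - 2"
    unfolding z
    by (simp only: lap_add lap_cmult lap_mult lap_const lap_gradient_coord gradient_coord assms C) simp
qed

lemma g_pos: "0 < g x" by (simp add: g_def)

lemma g_derivatives:
  assumes "x \<in> S"
  shows "de g x = g x * (p * de lw x)" "dn g x = g x * (p * dn lw x)"
    "lap g x = g x * (p * lap lw x + p\<^sup>2 * ((de lw x)\<^sup>2 + (dn lw x)\<^sup>2))"
proof -
  have C: "Ck_on 2 S (\<lambda>x. p * lw x)" by (intro Ck_on_mult Ck_on_const Ck_on_lw open_S)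
  have D: "de (\<lambda>x. p * lw x) x = p * de lw x" "dn (\<lambda>x. p * lw x) x = p * dn lw x"
    using C2_diff[OF Ck_on_lw assms] by (simp_all add: de_mult dn_mult de_const dn_const)
  show "de g x = g x * (p * de lw x)" "dn g x = g x * (p * dn lw x)"
    unfolding g_def[abs_def]
    using de_chain[OF C2_diff[OF C assms] DERIV_exp] dn_chain[OF C2_diff[OF C assms] DERIV_exp]
    by (simp_all add: D)
  show "lap g x = g x * (p * lap lw x + p\<^sup>2 * ((de lw x)\<^sup>2 + (dn lw x)\<^sup>2))"
    unfolding g_def[abs_def] lap_exp[OF C assms] D lap_cmult[OF Ck_on_lw assms]
    by (simp add: algebra_simps power2_eq_square)
qed

definition G :: "'a \<Rightarrow> real" where "G x = zeta x * g x"

lemma young: fixes t c :: real shows "c * \<bar>t\<bar> - t\<^sup>2 / 2 \<le> c\<^sup>2 / 2"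
proof -
  have "0 \<le> (\<bar>t\<bar> - c)\<^sup>2" by simp
  also have "\<dots> = t\<^sup>2 - 2 * (c * \<bar>t\<bar>) + c\<^sup>2" by (simp add: power2_diff)
  finally show ?thesis by simp
qed

text \<open>The factor \<open>zeta\<close> contributes \<open>- 2 g\<close>. All other terms carry a factor \<open>p\<close>, once the
  gradient of the logarithm has been eliminated by completing the square, and \<open>p_const\<close> is chosen so that they sum
  up to at most \<open>g\<close>.\<close>

lemma lap_G_le:
  assumes "x \<in> S"
  shows "lap G x \<le> - g x"
proof -
  let ?a = "de lw x" and ?b = "dn lw x"
  let ?q = "?a\<^sup>2 + ?b\<^sup>2" and ?t = "\<bar>?a\<bar> + \<bar>?b\<bar>"
  note p = p_bounds and z = zeta_bounds[OF assms]
  have R2: "1 \<le> R\<^sup>2" "R \<le> R\<^sup>2" using R_ge by (simp_all add: self_le_power)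
  have yR: "\<bar>dd e u x\<bar> \<le> R" "\<bar>dd n u x\<bar> \<le> R"
    using gradient_le[OF assms] R_ge abs_le_square_iff[of "dd e u x" R] abs_le_square_iff[of "dd n u x" R]
      zero_le_power2[of "dd e u x"] zero_le_power2[of "dd n u x"] by simp_all
  have "- (dd e u x * ?a) \<le> R * \<bar>?a\<bar>" "- (dd n u x * ?b) \<le> R * \<bar>?b\<bar>"
    using yR by (auto intro: mult_le_mult_abs)
  then have cross: "- (dd e u x * ?a + dd n u x * ?b) \<le> R\<^sup>2 * ?t"
    using R2 mult_right_mono[OF R2(2), of ?t] by (simp add: algebra_simps)
  have q0: "0 \<le> ?q" and t0: "0 \<le> ?t" by auto
  have "lap lw x + p * ?q \<le> (B + B * ?t) - (1 - p) * ?q"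
    using lap_lw_le[OF assms] by (simp add: algebra_simps)
  also have "\<dots> \<le> (B + B * ?t) - 1/2 * ?q"
    using p q0 by (intro diff_left_mono mult_right_mono) auto
  finally have "zeta x * (lap lw x + p * ?q) \<le> zeta x * (B + B * ?t) - zeta x * (1/2 * ?q)"
    using mult_left_mono[of "lap lw x + p * ?q" "(B + B * ?t) - 1/2 * ?q" "zeta x"] z R2
    by (simp add: algebra_simps)
  also have "\<dots> \<le> 2 * R\<^sup>2 * (B + B * ?t) - R\<^sup>2 * (1/2 * ?q)"
    using z q0 t0 B_nonneg by (intro diff_mono mult_right_mono) auto
  finally have "zeta x * (lap lw x + p * ?q) - 2 * (dd e u x * ?a + dd n u x * ?b)
      \<le> R\<^sup>2 * (2 * B + ((2 * B + 2) * ?t - 1/2 * ?q))"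
    using cross by (simp add: algebra_simps)
  also have "\<dots> \<le> R\<^sup>2 * (2 * B + 4 * (B + 1)\<^sup>2)"
  proof -
    have "(2 * B + 2) * ?t - 1/2 * ?q \<le> (2 * B + 2)\<^sup>2"
      using young[of "2 * B + 2" ?a] young[of "2 * B + 2" ?b] by (simp add: algebra_simps)
    then show ?thesis using R2 by (intro mult_left_mono) (auto simp: power2_eq_square algebra_simps)
  qed
  finally have "p * (zeta x * (lap lw x + p * ?q) - 2 * (dd e u x * ?a + dd n u x * ?b)) \<le> 1"
    using p mult_left_mono[of _ "R\<^sup>2 * (2 * B + 4 * (B + 1)\<^sup>2)" p] by simp
  then have "g x * (p * (zeta x * (lap lw x + p * ?q) - 2 * (dd e u x * ?a + dd n u x * ?b)) - 2) \<le> g x * (-1)"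
    using g_pos[of x] by (intro mult_left_mono) auto
  moreover have "lap G x = g x * (p * (zeta x * (lap lw x + p * ?q) - 2 * (dd e u x * ?a + dd n u x * ?b)) - 2)"
    unfolding G_def[abs_def] lap_mult[OF Ck_on_zeta Ck_on_g assms] g_derivatives[OF assms] zeta_derivatives[OF assms]
    by (simp add: algebra_simps power2_eq_square)
  ultimately show ?thesis by simp
qed

text \<open>In the degenerate limit \<open>wee = wen = 0\<close> the function \<open>x \<bullet> e\<close> is constant in \<open>y\<close> and \<open>x \<bullet> n\<close> is a function of
  \<open>y \<bullet> n\<close> alone. The growth of \<open>E\<close> in \<open>y \<bullet> e\<close> then compensates the concavity of the cutoff \<open>s\<^sup>2\<close>,
  and the term with \<open>Q\<close> makes \<open>A\<close> nonpositive on the unit circle at no cost.\<close>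

definition s :: "'a \<Rightarrow> real" where "s x = 1 - (x \<bullet> n) * (x \<bullet> n)"
definition E :: "'a \<Rightarrow> real" where "E x = exp (k * dd e u x)"
definition A :: "'a \<Rightarrow> real" where "A x = E x * (s x * s x) - Q * ((x \<bullet> e) * (x \<bullet> e))"

lemma Ck_on_s: "Ck_on 2 S s" and Ck_on_E: "Ck_on 2 S E"
  unfolding s_def[abs_def] E_def[abs_def]
  by (intro Ck_on_exp Ck_on_mult Ck_on_diff Ck_on_const Ck_on_inner Ck2_dd_u open_S)+

lemma Ck_on_A: "Ck_on 2 S A"
  unfolding A_def[abs_def]
  by (intro Ck_on_diff Ck_on_mult Ck_on_const Ck_on_inner Ck_on_s Ck_on_E open_S)

lemma E_derivatives:
  assumes "x \<in> S"
  shows "de E x = k * E x" "dn E x = 0" "lap E x = k\<^sup>2 * E x"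
proof -
  have C: "Ck_on 2 S (\<lambda>x. k * dd e u x)" by (intro Ck_on_mult Ck_on_const Ck2_dd_u open_S)
  have D: "de (\<lambda>x. k * dd e u x) x = k" "dn (\<lambda>x. k * dd e u x) x = 0"
    using C2_diff[OF Ck2_dd_u assms]
    by (simp_all add: de_mult dn_mult de_const dn_const gradient_coord[OF assms])
  show "de E x = k * E x" "dn E x = 0"
    unfolding E_def[abs_def]
    using de_chain[OF C2_diff[OF C assms] DERIV_exp] dn_chain[OF C2_diff[OF C assms] DERIV_exp]
    by (simp_all add: D)
  show "lap E x = k\<^sup>2 * E x"
    unfolding E_def[abs_def] lap_exp[OF C assms] D lap_cmult[OF Ck2_dd_u assms]
    by (simp add: lap_gradient_coord[OF assms])
qed

lemma s_derivatives:
  assumes "x \<in> S"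
  shows "de s x = - (2 * (x \<bullet> n) * wen x)" "dn s x = - (2 * (x \<bullet> n) * wnn x)"
    "lap s x = - (2 * (x \<bullet> n) * dn h x + 2 * (wen x * wen x + wnn x * wnn x))"
proof -
  have s: "s = (\<lambda>x. 1 + (-1) * ((x \<bullet> n) * (x \<bullet> n)))" by (auto simp: s_def)
  note C = Ck_on_inner[of 2 S n] Ck_on_mult[OF open_S Ck_on_inner Ck_on_inner, of 2 n n] 
     Ck_on_mult[OF open_S Ck_on_const Ck_on_mult[OF open_S Ck_on_inner Ck_on_inner], of 2 _ n n] Ck_on_const
  show "de s x = - (2 * (x \<bullet> n) * wen x)" "dn s x = - (2 * (x \<bullet> n) * wnn x)"
    unfolding s
    by (simp_all only: de_add dn_add de_mult dn_mult de_const dn_const de_coord dn_coord C2_diff[OF _ assms] C) simp_all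
  show "lap s x = - (2 * (x \<bullet> n) * dn h x + 2 * (wen x * wen x + wnn x * wnn x))"
    unfolding s
    by (simp only: lap_add lap_cmult lap_mult lap_const de_coord dn_coord lap_coord assms C) simp
qed

lemma lap_A_eq:
  assumes "x \<in> S"
  shows "lap A x = E x * (k\<^sup>2 * (s x)\<^sup>2 - 4 * s x * (x \<bullet> n) * dn h x - 4 * s x * (wen x * wen x + wnn x * wnn x)
       + 8 * (x \<bullet> n)\<^sup>2 * (wen x * wen x + wnn x * wnn x) - 8 * k * s x * (x \<bullet> n) * wen x)
       - Q * (2 * (x \<bullet> e) * de h x + 2 * (wee x * wee x + wen x * wen x))"
proof -
  have A: "A = (\<lambda>x. E x * (s x * s x) + (- Q) * ((x \<bullet> e) * (x \<bullet> e)))" by (auto simp: A_def)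
  note C = Ck_on_s Ck_on_E Ck_on_mult[OF open_S Ck_on_s Ck_on_s] 
     Ck_on_mult[OF open_S Ck_on_E Ck_on_mult[OF open_S Ck_on_s Ck_on_s]] Ck_on_const
     Ck_on_inner[of 2 S e] Ck_on_mult[OF open_S Ck_on_inner Ck_on_inner, of 2 e e] 
     Ck_on_mult[OF open_S Ck_on_const Ck_on_mult[OF open_S Ck_on_inner Ck_on_inner], of 2 _ e e]
  have "lap A x = E x * (2 * s x * lap s x + 2 * ((de s x)\<^sup>2 + (dn s x)\<^sup>2)) + s x * s x * lap E x
      + 4 * s x * (de E x * de s x + dn E x * dn s x)
      - Q * (2 * (x \<bullet> e) * de h x + 2 * (wee x * wee x + wen x * wen x))"
    unfolding A lap_add[OF C(4) C(8) assms] lap_cmult[OF C(7) assms] lap_mult[OF C(2,3) assms]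
      lap_mult[OF C(1,1) assms] lap_mult[OF C(6,6) assms] lap_coord[OF assms] de_coord dn_coord
      de_mult[OF C2_diff[OF C(1) assms] C2_diff[OF C(1) assms]]
      dn_mult[OF C2_diff[OF C(1) assms] C2_diff[OF C(1) assms]]
    by (simp add: algebra_simps power2_eq_square)
  then show ?thesis
    unfolding E_derivatives[OF assms] s_derivatives[OF assms]
    by (simp add: algebra_simps power2_eq_square)
qed

lemma gradient_abs_le:
  assumes "x \<in> S" shows "\<bar>dd e u x\<bar> \<le> R"
  using gradient_le[OF assms] R_ge abs_le_square_iff[of "dd e u x" R] zero_le_power2[of "dd n u x"] by simp

lemma E_le: "x \<in> S \<Longrightarrow> E x \<le> Q" and E_pos: "0 < E x" and E_ge: "x \<in> S \<Longrightarrow> 1 / Q \<le> E x"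
proof -
  assume "x \<in> S"
  then have "- R \<le> dd e u x" "dd e u x \<le> R" using gradient_abs_le[of x] by auto
  then have 1: "k * dd e u x \<le> k * R" and "k * (- R) \<le> k * dd e u x"
    using k_pos by (intro mult_left_mono; simp)+
  then have 2: "- (k * R) \<le> k * dd e u x" by simp
  show "E x \<le> Q" unfolding E_def Q_const_def using 1 by simp
  show "1 / Q \<le> E x" unfolding E_def Q_const_def using 2
    by (simp add: exp_minus[symmetric] inverse_eq_divide[symmetric])
qed (simp add: E_def)

text \<open>Since \<open>wee / H\<close> is at most \<open>1\<close> and \<open>p\<close> at most \<open>1/2\<close>, the square root of \<open>wee / H\<close> is at most its power \<open>p\<close>.\<close>

lemma sqrt_le_g:
  assumes "x \<in> S"
  shows "sqrt (H * wee x) \<le> H * g x"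
proof -
  note w = wee_pos[OF assms]
  have Hp: "0 < H" using H_ge by simp
  have "lw x \<le> ln H" unfolding lw_def using w w_bounds(1)[OF assms] Hp by simp
  then have "(1/2 - p) * lw x \<le> (1/2 - p) * ln H" using p_bounds by (intro mult_left_mono) auto
  also have "\<dots> \<le> 1/2 * ln H" using p_bounds H_ge by (intro mult_right_mono) auto
  finally have "(ln H + lw x) / 2 \<le> ln H + p * lw x" by (simp add: algebra_simps)
  then have "exp ((ln H + lw x) / 2) \<le> exp (ln H + p * lw x)" by simp
  moreover have "sqrt (H * wee x) = exp ((ln H + lw x) / 2)"
  proof (rule real_sqrt_unique)
    have "(exp ((ln H + lw x) / 2))\<^sup>2 = exp (ln H + lw x)"
      by (simp add: power2_eq_square exp_add[symmetric])
    then show "(exp ((ln H + lw x) / 2))\<^sup>2 = H * wee x"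
      using w Hp by (simp add: exp_add lw_def)
  qed simp
  ultimately show ?thesis using Hp by (simp add: exp_add g_def)
qed

text \<open>Let \<open>\<rho>\<close> be the length of the second row of the inverse Hessian. The first four terms in the bracket of
  \<open>lap_A_eq\<close> are at least \<open>k\<^sup>2 s\<^sup>2 - k s \<rho> + 8 \<rho>\<^sup>2\<close>, which is nonnegative: near the boundary of the cutoff the
  term in \<open>\<rho>\<^sup>2\<close> dominates, inside it the term in \<open>s\<^sup>2\<close>. The remaining terms are at most a multiple of
  \<open>\<tau>\<close>, the bound for the length of the first row.\<close>

lemma lap_A_ge:
  assumes "x \<in> S" "norm x \<le> 1"
  shows "- (N - 1) * g x \<le> lap A x"
proof -
  define t where "t = x \<bullet> n"
  define \<tau> where "\<tau> = sqrt (H * wee x)"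
  define \<rho> where "\<rho> = sqrt (wen x * wen x + wnn x * wnn x)"
  note w = wee_pos[OF assms(1)] and wb = w_bounds[OF assms(1)]
  have Hp: "0 < H" using H_ge by simp
  have \<tau>0: "0 \<le> \<tau>" and \<rho>0: "0 \<le> \<rho>" unfolding \<tau>_def \<rho>_def using w Hp by auto
  have \<tau>2: "\<tau>\<^sup>2 = H * wee x" and \<rho>2: "wen x * wen x + wnn x * wnn x = \<rho>\<^sup>2"
    unfolding \<tau>_def \<rho>_def using w Hp by (auto simp: real_sqrt_pow2)
  have \<tau>H: "\<tau> \<le> H"
    unfolding \<tau>_def using wb(1) Hp by (intro real_le_lsqrt) (auto simp: power2_eq_square)
  have \<rho>H: "\<rho> \<le> H"
    unfolding \<rho>_def using wb(3) Hp by (intro real_le_lsqrt) (auto simp: power2_eq_square)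
  have xi: "norm (wee x *\<^sub>R e + wen x *\<^sub>R n) \<le> \<tau>"
  proof (rule power2_le_imp_le[OF _ \<tau>0])
    show "(norm (wee x *\<^sub>R e + wen x *\<^sub>R n))\<^sup>2 \<le> \<tau>\<^sup>2"
      unfolding norm_frame \<tau>2 using wb(2) by (simp add: power2_eq_square)
  qed
  have "wen x * wen x \<le> \<tau>\<^sup>2" using wb(2) \<tau>2 zero_le_square[of "wee x"] by linarith
  then have wen: "\<bar>wen x\<bar> \<le> \<tau>"
    using \<tau>0 abs_le_square_iff[of "wen x" \<tau>] by (simp add: power2_eq_square)
  have deh: "\<bar>de h x\<bar> \<le> B * \<tau>"
    using dd_h_le[OF assms(1), of "wee x *\<^sub>R e + wen x *\<^sub>R n"] mult_left_mono[OF xi B_nonneg]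
    unfolding de_def by linarith
  have "norm (wen x *\<^sub>R e + wnn x *\<^sub>R n) = \<rho>"
  proof (rule power2_eq_imp_eq[OF _ norm_ge_zero \<rho>0])
    show "(norm (wen x *\<^sub>R e + wnn x *\<^sub>R n))\<^sup>2 = \<rho>\<^sup>2"
      unfolding norm_frame \<rho>2[symmetric] by (simp add: power2_eq_square)
  qed
  then have dnh: "\<bar>dn h x\<bar> \<le> B * \<rho>"
    using dd_h_le[OF assms(1), of "wen x *\<^sub>R e + wnn x *\<^sub>R n"] unfolding dn_def by simp
  have "(norm x)\<^sup>2 \<le> 1" using assms(2) by (simp add: power_le_one)
  then have "(x \<bullet> e)\<^sup>2 \<le> 1\<^sup>2" "t\<^sup>2 \<le> 1\<^sup>2"
    using norm_sq_coord[of x] zero_le_power2[of "x \<bullet> e"] zero_le_power2[of "x \<bullet> n"]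
    unfolding t_def power_one by linarith+
  then have xe: "\<bar>x \<bullet> e\<bar> \<le> 1" and t: "\<bar>t\<bar> \<le> 1" "t\<^sup>2 \<le> 1"
    using abs_le_square_iff[of "x \<bullet> e" 1] abs_le_square_iff[of t 1] by simp_all
  have s: "s x = 1 - t\<^sup>2" by (simp add: s_def t_def power2_eq_square)
  have s01: "0 \<le> s x" "s x \<le> 1" using t s by simp_all
  have "\<bar>t * dn h x\<bar> \<le> 1 * (B * \<rho>)"
    unfolding abs_mult using t dnh B_nonneg \<rho>0 by (intro mult_mono) auto
  then have "4 * s x * (t * dn h x) \<le> 4 * s x * (B * \<rho>)"
    using s01 by (intro mult_left_mono) auto
  moreover have "\<bar>t * wen x\<bar> \<le> 1 * \<tau>"
    unfolding abs_mult using t wen by (intro mult_mono) auto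
  then have "s x * (t * wen x) \<le> 1 * \<tau>"
    using s01 \<tau>0 mult_mono[of "s x" 1 "\<bar>t * wen x\<bar>" \<tau>] mult_left_mono[OF abs_ge_self[of "t * wen x"] s01(1)]
    by simp
  then have "8 * k * (s x * (t * wen x)) \<le> 8 * k * (1 * \<tau>)"
    using k_pos by (intro mult_left_mono) auto
  moreover have "12 * s x * \<rho> * \<rho> \<le> 12 * s x * \<rho> * H"
    using s01 \<rho>0 \<rho>H by (intro mult_left_mono) auto
  moreover have "k * s x * \<rho> \<le> k\<^sup>2 * (s x)\<^sup>2 + 8 * \<rho>\<^sup>2"
  proof -
    have "0 \<le> (k * s x - \<rho> / 2)\<^sup>2" by simp
    also have "\<dots> = k\<^sup>2 * (s x)\<^sup>2 - k * s x * \<rho> + \<rho>\<^sup>2 / 4"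
      by (simp add: power2_eq_square algebra_simps)
    finally have "k * s x * \<rho> \<le> k\<^sup>2 * (s x)\<^sup>2 + \<rho>\<^sup>2 / 4" by simp
    then show ?thesis using zero_le_power2[of \<rho>] by linarith
  qed
  moreover have "k * s x * \<rho> = 12 * s x * \<rho> * H + 4 * s x * (B * \<rho>)"
    by (simp add: k_const_def algebra_simps)
  moreover have "8 * t\<^sup>2 * \<rho>\<^sup>2 = 8 * \<rho>\<^sup>2 - 8 * s x * \<rho>\<^sup>2" by (simp add: s algebra_simps)
  ultimately have "- (8 * k * \<tau>) \<le> k\<^sup>2 * (s x)\<^sup>2 - 4 * s x * t * dn h x - 4 * s x * \<rho>\<^sup>2
       + 8 * t\<^sup>2 * \<rho>\<^sup>2 - 8 * k * s x * t * wen x"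
    by (simp add: power2_eq_square algebra_simps)
  from mult_left_mono[OF this less_imp_le[OF E_pos[of x]]]
  have "- (E x * (8 * k * \<tau>)) \<le> E x * (k\<^sup>2 * (s x)\<^sup>2 - 4 * s x * t * dn h x - 4 * s x * \<rho>\<^sup>2
       + 8 * t\<^sup>2 * \<rho>\<^sup>2 - 8 * k * s x * t * wen x)" by simp
  moreover have "E x * (8 * k * \<tau>) \<le> Q * (8 * k * \<tau>)"
    using E_le[OF assms(1)] k_pos \<tau>0 by (intro mult_right_mono) auto
  moreover have "Q * (2 * (x \<bullet> e) * de h x + 2 * (wee x * wee x + wen x * wen x)) \<le> Q * (2 * B * \<tau> + 2 * H * \<tau>)"
  proof (intro mult_left_mono)
    have "\<bar>(x \<bullet> e) * de h x\<bar> \<le> 1 * (B * \<tau>)"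
      unfolding abs_mult using xe deh by (intro mult_mono) auto
    moreover have "wee x * wee x + wen x * wen x \<le> H * \<tau>"
      using wb(2) \<tau>2 mult_right_mono[OF \<tau>H \<tau>0] by (simp add: power2_eq_square)
    ultimately show "2 * (x \<bullet> e) * de h x + 2 * (wee x * wee x + wen x * wen x) \<le> 2 * B * \<tau> + 2 * H * \<tau>"
      by simp
  qed (use Q_ge in simp)
  ultimately have "- (Q * (8 * k + 2 * B + 2 * H) * \<tau>) \<le> lap A x"
    unfolding lap_A_eq[OF assms(1)] t_def[symmetric] \<rho>2 by (simp add: algebra_simps)
  moreover have "Q * (8 * k + 2 * B + 2 * H) * \<tau> \<le> Q * (8 * k + 2 * B + 2 * H) * (H * g x)"
    using sqrt_le_g[OF assms(1)] Q_ge k_pos B_nonneg H_ge unfolding \<tau>_def by (intro mult_left_mono) auto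
  ultimately show ?thesis by (simp add: N_const_def algebra_simps)
qed

text \<open>On the unit circle \<open>s\<close> equals \<open>(x \<bullet> e)\<^sup>2\<close>, and \<open>s\<^sup>2 \<le> s\<close>.\<close>

lemma A_boundary:
  assumes "x \<in> S" "norm x = 1"
  shows "A x \<le> 0"
proof -
  have s: "s x = (x \<bullet> e) * (x \<bullet> e)"
    using norm_sq_coord[of x] assms(2) by (simp add: s_def power2_eq_square)
  have s01: "0 \<le> s x" "s x \<le> 1"
    unfolding s by simp (simp add: s[symmetric] s_def)
  have "E x * (s x * s x) \<le> Q * (1 * s x)"
    using E_le[OF assms(1)] E_pos[of x] s01 by (intro mult_mono) auto
  then show ?thesis by (simp add: A_def s)
qed

text \<open>An interior maximum of \<open>A - N G\<close> would contradict \<open>lap_A_ge\<close> and \<open>lap_G_le\<close>, which together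
  make its Laplacian at least \<open>g > 0\<close>. So the maximum over the unit disc lies on the circle and is nonpositive.\<close>

theorem wee_0_ge: "c_const H B R \<le> wee 0"
proof -
  define \<Phi> where "\<Phi> x = A x + (- N) * G x" for x
  have C2: "Ck_on 2 S \<Phi>"
    unfolding \<Phi>_def[abs_def] G_def[abs_def]
    by (intro Ck_on_add Ck_on_mult Ck_on_const Ck_on_A Ck_on_zeta Ck_on_g open_S)
  have G2: "Ck_on 2 S G" unfolding G_def[abs_def] by (intro Ck_on_mult Ck_on_zeta Ck_on_g open_S)
  have "continuous_on (cball 0 1) \<Phi>"
    using Ck_on_imp_continuous[OF C2] unit_ball continuous_on_subset by blast
  then obtain z where z: "z \<in> cball 0 1" and max: "\<And>y. y \<in> cball 0 1 \<Longrightarrow> \<Phi> y \<le> \<Phi> z"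
    using continuous_attains_sup[of "cball (0::'a) 1" \<Phi>] by auto
  have zS: "z \<in> S" and S0: "0 \<in> S" using z unit_ball by auto
  have G_nonneg: "0 \<le> G x" if "x \<in> S" for x
    using zeta_bounds[OF that] g_pos[of x] zero_le_power2[of R] unfolding G_def by (intro mult_nonneg_nonneg) linarith+
  have "norm z = 1"
  proof (rule ccontr)
    assume "norm z \<noteq> 1"
    with z have zb: "z \<in> ball 0 1" by simp
    have "lap \<Phi> z \<le> 0"
      using zb unit_ball max by (intro lap_nonpos_at_max[OF C2, of "ball 0 1"]) auto
    moreover have "lap \<Phi> z = lap A z + (- N) * lap G z"
      unfolding \<Phi>_def[abs_def] 
      by (simp only: lap_add lap_cmult Ck_on_A G2 Ck_on_mult[OF open_S Ck_on_const G2] zS)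
    moreover have "N * lap G z \<le> N * (- g z)"
      using lap_G_le[OF zS] N_ge by (intro mult_left_mono) auto
    moreover have "- (N - 1) * g z \<le> lap A z" using z by (intro lap_A_ge[OF zS]) simp
    ultimately show False using g_pos[of z] by (simp add: algebra_simps)
  qed
  then have "A z \<le> 0" by (rule A_boundary[OF zS])
  moreover have "0 \<le> N * G z" using G_nonneg[OF zS] N_ge by simp
  ultimately have "\<Phi> z \<le> 0" by (simp add: \<Phi>_def)
  then have "A 0 \<le> N * G 0" using max[of 0] by (simp add: \<Phi>_def)
  moreover have "A 0 = E 0" by (simp add: A_def s_def)
  moreover have "N * G 0 \<le> N * (2 * R\<^sup>2 * g 0)"
    unfolding G_def using zeta_bounds[OF S0] g_pos[of 0] N_ge by (intro mult_left_mono mult_right_mono) auto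
  ultimately have "1 / Q \<le> N * (2 * R\<^sup>2 * g 0)" using E_ge[OF S0] by linarith
  then have "1 \<le> (2 * Q * N * R\<^sup>2) * g 0" using Q_ge by (simp add: field_simps)
  moreover have K: "0 < 2 * Q * N * R\<^sup>2" using Q_ge N_ge R_ge by simp
  ultimately have "ln 1 \<le> ln ((2 * Q * N * R\<^sup>2) * g 0)" by (subst ln_le_cancel_iff) (auto simp: g_pos)
  also have "\<dots> = ln (2 * Q * N * R\<^sup>2) + p * lw 0" using K by (subst ln_mult) (auto simp: g_pos g_def)
  finally have "- ln (2 * Q * N * R\<^sup>2) / p \<le> lw 0" using p_bounds(1) by (simp add: field_simps)
  then have "exp (- ln (2 * Q * N * R\<^sup>2) / p) \<le> exp (lw 0)" by simp
  then show ?thesis using wee_pos[OF S0] by (simp add: c_const_def lw_def)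
qed

end

section \<open>Structure conditions from the equation\<close>

text \<open>Bounds for \<open>h = 1 / F\<close> and for its derivatives, where \<open>m\<close> is a lower bound of \<open>F\<close> and \<open>K\<close> controls the first
  two derivatives of \<open>F\<close>.\<close>

definition H_const :: "real \<Rightarrow> real" where "H_const m = max 1 (1 / m)"
definition B_const :: "real \<Rightarrow> real \<Rightarrow> real" where
  "B_const m K = K * (H_const m)\<^sup>2 + K * (H_const m)^3 + 2 * K\<^sup>2 * (H_const m)^4"

context hessian_frame
begin

text \<open>For \<open>\<xi> = We\<close> the quadratic form of the Hessian is \<open>We \<bullet> e\<close>, as \<open>W\<close> is its inverse.\<close>

lemma dd_dd_u_eq_wee:
  assumes "x \<in> S" and \<xi>: "\<xi> = wee x *\<^sub>R e + wen x *\<^sub>R n"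
  shows "dd \<xi> (dd \<xi> u) x = wee x"
proof -
  have d: "u differentiable (at y)" if "y \<in> S" for y
    using Ck_on_differentiable[OF u_C4 _ that] by simp
  have C: "dd v u differentiable (at x)" for v
    using Ck_on_differentiable[OF Ck_on_dd_u _ assms(1)] by simp
  have "dd \<xi> (dd \<xi> u) x = dd \<xi> (\<lambda>y. wee x * dd e u y + wen x * dd n u y) x"
    unfolding \<xi> by (intro dd_cong_open[OF open_S assms(1)] dd_comb d)
  also have "\<dots> = wee x * dd \<xi> (dd e u) x + wen x * dd \<xi> (dd n u) x"
    using C by (simp add: dd_add dd_mult)
  also have "\<dots> = wee x"
    using gradient_coord[OF assms(1)] unfolding de_def \<xi>[symmetric] by simp
  finally show ?thesis .
qed

text \<open>The second derivative of \<open>F\<close> is allowed to contain that of \<open>u\<close>, since along \<open>\<xi> = We\<close> the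
  latter is just \<open>wee\<close>. The bound on the squared length of \<open>\<xi>\<close> is again of order \<open>wee\<close>.\<close>

lemma bounded_frame_of_quotient_equation:
  assumes eq: "\<And>x. x \<in> S \<Longrightarrow> F x * (uee x + unn x) = uee x * unn x - (uen x)\<^sup>2"
    and m: "0 < m" "\<And>x. x \<in> S \<Longrightarrow> m \<le> F x"
    and K: "\<And>x v. x \<in> S \<Longrightarrow> \<bar>dd v F x\<bar> \<le> K * norm v"
    and K2: "\<And>x v. x \<in> S \<Longrightarrow> \<bar>dd v (dd v F) x\<bar> \<le> K * \<bar>dd v (dd v u) x\<bar> + K * (norm v)\<^sup>2"
    and K_nonneg: "0 \<le> K"
    and R: "1 \<le> R" "\<And>x. x \<in> S \<Longrightarrow> (dd e u x)\<^sup>2 + (dd n u x)\<^sup>2 \<le> R\<^sup>2"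
    and ball: "cball 0 1 \<subseteq> S"
  shows "bounded_hessian_frame S u e n (H_const m) (B_const m K) R"
proof -
  define H where "H = H_const m"
  define B where "B = B_const m K"
  have H: "1 \<le> H" "1 / m \<le> H" by (simp_all add: H_def H_const_def)
  have HB: "K * H\<^sup>2 \<le> B" "B = K * H\<^sup>2 + K * H^3 + 2 * K\<^sup>2 * H^4" and B0: "0 \<le> B"
    using K_nonneg H by (simp_all add: B_def B_const_def H_def[symmetric])
  have hF: "h x * F x = 1" if "x \<in> S" for x
  proof -
    have "h x * F x = J x * (F x * (uee x + unn x))" by (simp add: h_def wee_def wnn_def algebra_simps)
    then show ?thesis using J_eq[OF that] eq[OF that] by (simp add: power2_eq_square)
  qed
  have Fpos: "0 < F x" if "x \<in> S" for x using m that by force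
  have hpos: "0 < h x" if "x \<in> S" for x using wee_pos[OF that] wnn_pos[OF that] by (simp add: h_def)
  have h_inv: "h x = inverse (F x)" "inverse (h x) = F x" if "x \<in> S" for x
    using inverse_unique[of "F x" "h x"] inverse_unique[of "h x" "F x"] hF[OF that] by (simp_all add: mult.commute)
  have FC: "Ck_on 2 S F"
    by (rule Ck_on_cong_open[OF open_S h_inv(2) Ck_on_inverse[OF open_S hpos Ck_on_h]])
  have hH: "h x \<le> H" if "x \<in> S" for x
  proof -
    have "inverse (F x) \<le> inverse m" using m that by (intro le_imp_inverse_le) auto
    then show ?thesis using H h_inv that by (simp add: inverse_eq_divide)
  qed
  have dh: "dd v h x = - (dd v F x * (h x * h x))" if "x \<in> S" for x v
  proof -
    have "dd v h x = dd v (\<lambda>y. inverse (F y)) x"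
      by (rule dd_cong_open[OF open_S that h_inv(1)])
    also have "\<dots> = - (inverse (F x) ^ Suc (Suc 0)) * dd v F x"
      using Fpos[OF that] by (intro dd_chain[OF C2_diff[OF FC that] DERIV_inverse]) simp
    finally show ?thesis using h_inv[OF that] by simp
  qed
  have ddh: "dd v (dd v h) x = - (dd v (dd v F) x * (h x)\<^sup>2) + 2 * (dd v F x)\<^sup>2 * (h x)^3" if "x \<in> S" for x v
  proof -
    note d = C2_diff[OF Ck_on_h that] dd_diff[OF FC that]
    have "dd v (dd v h) x = dd v (\<lambda>y. - (dd v F y * (h y * h y))) x"
      by (rule dd_cong_open[OF open_S that dh])
    also have "\<dots> = - (dd v (dd v F) x * (h x * h x) + dd v F x * (2 * h x * dd v h x))"
      using d by (simp add: dd_uminus dd_mult)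
    finally show ?thesis unfolding dh[OF that] by (simp add: power2_eq_square power3_eq_cube algebra_simps)
  qed
  have hsq: "(h x)\<^sup>2 \<le> H\<^sup>2" "(h x)^3 \<le> H^3" if "x \<in> S" for x
    using hH[OF that] hpos[OF that] by (intro power_mono; simp)+
  have "\<bar>dd v h x\<bar> \<le> B * norm v" if "x \<in> S" for x v
  proof -
    have "\<bar>dd v h x\<bar> = \<bar>dd v F x\<bar> * (h x)\<^sup>2"
      unfolding dh[OF that] by (simp add: abs_mult power2_eq_square)
    also have "\<dots> \<le> (K * norm v) * H\<^sup>2"
      using K[OF that] hsq[OF that] K_nonneg by (intro mult_mono) auto
    also have "\<dots> \<le> B * norm v"
      using mult_right_mono[OF HB(1) norm_ge_zero[of v]] by (simp add: algebra_simps)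
    finally show ?thesis .
  qed
  moreover have "dd \<xi> (dd \<xi> h) x \<le> B * wee x"
    if x: "x \<in> S" and \<xi>: "\<xi> = wee x *\<^sub>R e + wen x *\<^sub>R n" for x \<xi>
  proof -
    have w0: "0 \<le> wee x" using wee_pos[OF x] by simp
    have "(norm \<xi>)\<^sup>2 = wee x * wee x + wen x * wen x"
      unfolding \<xi> power2_norm_eq_inner using frame by (simp add: inner_simps inner_commute[of n e])
    also have "\<dots> \<le> h x * wee x"
      using wen_sq_le[OF x] by (simp add: h_def algebra_simps)
    also have "\<dots> \<le> H * wee x" using hH[OF x] w0 by (intro mult_right_mono)
    finally have N: "(norm \<xi>)\<^sup>2 \<le> H * wee x" .
    have "\<bar>dd \<xi> (dd \<xi> F) x\<bar> \<le> K * wee x + K * (norm \<xi>)\<^sup>2"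
      using K2[OF x, of \<xi>] w0 by (simp add: dd_dd_u_eq_wee[OF x \<xi>])
    also have "\<dots> \<le> K * wee x + K * (H * wee x)"
      using N K_nonneg by (intro add_left_mono mult_left_mono)
    finally have a: "\<bar>dd \<xi> (dd \<xi> F) x\<bar> * (h x)\<^sup>2 \<le> (K * wee x + K * (H * wee x)) * H\<^sup>2"
      using hsq[OF x] w0 K_nonneg H by (intro mult_mono) auto
    have "(dd \<xi> F x)\<^sup>2 \<le> (K * norm \<xi>)\<^sup>2"
      using K[OF x, of \<xi>] by (metis abs_ge_zero power2_abs power_mono)
    also have "\<dots> \<le> K\<^sup>2 * (H * wee x)"
      using N by (simp add: power_mult_distrib mult_left_mono)
    finally have "(dd \<xi> F x)\<^sup>2 * (h x)^3 \<le> (K\<^sup>2 * (H * wee x)) * H^3"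
      using hsq[OF x] w0 H hpos[OF x] by (intro mult_mono) auto
    moreover have "- (dd \<xi> (dd \<xi> F) x * (h x)\<^sup>2) \<le> \<bar>dd \<xi> (dd \<xi> F) x\<bar> * (h x)\<^sup>2"
      using mult_right_mono[OF abs_ge_minus_self[of "dd \<xi> (dd \<xi> F) x"] zero_le_power2[of "h x"]] by simp
    ultimately have "dd \<xi> (dd \<xi> h) x \<le> (K * wee x + K * (H * wee x)) * H\<^sup>2 + 2 * ((K\<^sup>2 * (H * wee x)) * H^3)"
      unfolding ddh[OF x] using a by linarith
    also have "\<dots> = B * wee x"
      unfolding HB(2) by (simp add: algebra_simps power2_eq_square power3_eq_cube power4_eq_xxxx)
    finally show ?thesis .
  qed
  ultimately have "bounded_hessian_frame_axioms S u e n H B R"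
    unfolding bounded_hessian_frame_axioms_def using H B0 R ball hH by blast
  then show ?thesis
    unfolding H_def B_def by (intro bounded_hessian_frame.intro hessian_frame_axioms)
qed

end

section \<open>Extracting pointwise bounds from convexity and norms\<close>

lemma real_derivative_le:
  fixes \<psi> :: "real \<Rightarrow> real"
  assumes "(\<psi> has_real_derivative d) (at 0)" "\<forall>\<^sub>F t in at_right 0. \<bar>\<psi> t - \<psi> 0\<bar> \<le> c * t"
  shows "\<bar>d\<bar> \<le> c"
proof -
  have "((\<lambda>t. (\<psi> t - \<psi> 0) / (t - 0)) \<longlongrightarrow> d) (at_right 0)"
    using assms(1) unfolding has_field_derivative_iff by (rule filterlim_mono[OF _ order_refl at_le]) simp
  then have "((\<lambda>t. \<bar>(\<psi> t - \<psi> 0) / (t - 0)\<bar>) \<longlongrightarrow> \<bar>d\<bar>) (at_right 0)"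
    by (rule tendsto_rabs)
  moreover have "\<forall>\<^sub>F t in at_right 0. \<bar>(\<psi> t - \<psi> 0) / (t - 0)\<bar> \<le> c"
    using assms(2) eventually_at_right_less[of 0]
    by eventually_elim (simp add: abs_divide divide_le_eq)
  ultimately show ?thesis by (rule tendsto_upperbound) simp
qed

lemma eventually_ray_in_open:
  fixes x :: "'a::real_normed_vector"
  assumes "open S" "x \<in> S"
  shows "\<forall>\<^sub>F t in at_right (0::real). x + t *\<^sub>R v \<in> S"
proof -
  have "((\<lambda>t. x + t *\<^sub>R v) \<longlongrightarrow> x + 0 *\<^sub>R v) (at_right 0)" by (intro tendsto_intros)
  then show ?thesis using assms topological_tendstoD by fastforce
qed

lemma dd_eq_grad:
  assumes "f differentiable (at x)"
  shows "dd v f x = grad f x \<bullet> v"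
proof -
  have "dd v f x = dd (\<Sum>b\<in>Basis. (v \<bullet> b) *\<^sub>R b) f x" by (simp add: euclidean_representation)
  also have "\<dots> = (\<Sum>b\<in>Basis. (v \<bullet> b) * dd b f x)"
    by (simp add: linear_sum[OF dd_linear[OF assms]] linear_scale[OF dd_linear[OF assms]])
  also have "\<dots> = grad f x \<bullet> v"
    by (simp add: grad_def dd_def inner_sum_left inner_commute[of v] mult.commute)
  finally show ?thesis .
qed

lemma dd_le_of_lipschitz:
  fixes f :: "'a::euclidean_space \<Rightarrow> real"
  assumes "open S" "x \<in> S" "f differentiable (at x)"
    and "\<And>y. y \<in> S \<Longrightarrow> \<bar>f y - f x\<bar> \<le> c * norm (y - x)"
  shows "\<bar>dd v f x\<bar> \<le> c * norm v"
proof (rule real_derivative_le)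
  show "((\<lambda>t. f (x + t *\<^sub>R v)) has_real_derivative dd v f x) (at 0)"
    using has_real_derivative_along_line[of f x 0 v] assms(3) by simp
  show "\<forall>\<^sub>F t in at_right 0. \<bar>f (x + t *\<^sub>R v) - f (x + 0 *\<^sub>R v)\<bar> \<le> c * norm v * t"
    using eventually_ray_in_open[OF assms(1,2), of v] eventually_at_right_less[of 0]
  proof eventually_elim
    case (elim t)
    then show ?case using assms(4)[OF elim(1)] by (simp add: algebra_simps)
  qed
qed

text \<open>The tangent affine function minus \<open>u\<close> is maximal at \<open>x\<close>, so the claim is the second derivative test.\<close>

lemma convex_on_imp_dd_dd_nonneg:
  fixes u :: "'a::euclidean_space \<Rightarrow> real"
  assumes "open S" "convex_on S u" "Ck_on 2 S u" "x \<in> S"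
  shows "0 \<le> dd v (dd v u) x"
proof -
  have d: "u differentiable (at y)" if "y \<in> S" for y
    using Ck_on_differentiable[OF assms(3) _ that] by simp
  have tangent: "u x + grad u x \<bullet> (y - x) \<le> u y" if y: "y \<in> S" for y
  proof -
    have "((\<lambda>t. u (x + t *\<^sub>R (y - x))) has_real_derivative dd (y - x) u x) (at 0)"
      using has_real_derivative_along_line[of u x 0 "y - x"] d[OF assms(4)] by simp
    then have "((\<lambda>t. (u (x + t *\<^sub>R (y - x)) - u x) / t) \<longlongrightarrow> dd (y - x) u x) (at_right 0)"
      unfolding has_field_derivative_iff by (auto intro: filterlim_mono[OF _ order_refl at_le])
    moreover have "\<forall>\<^sub>F t in at_right 0. (u (x + t *\<^sub>R (y - x)) - u x) / t \<le> u y - u x"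
      using eventually_at_right_real[of 0 1, simplified]
    proof eventually_elim
      case (elim t)
      then have "u ((1 - t) *\<^sub>R x + t *\<^sub>R y) \<le> (1 - t) * u x + t * u y"
        using assms(2,4) y by (intro convex_onD) auto
      moreover have "(1 - t) *\<^sub>R x + t *\<^sub>R y = x + t *\<^sub>R (y - x)" by (simp add: algebra_simps)
      ultimately have "u (x + t *\<^sub>R (y - x)) - u x \<le> (u y - u x) * t" by (simp add: algebra_simps)
      then show ?case using elim by (simp add: divide_le_eq)
    qed
    ultimately have "dd (y - x) u x \<le> u y - u x" by (rule tendsto_upperbound) simp
    then show ?thesis by (simp add: dd_eq_grad[OF d[OF assms(4)]])
  qed
  (* Up to a constant, the tangent affine function minus u. *)
  define \<phi> where "\<phi> y = y \<bullet> grad u x - u y" for y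
  have "Ck_on 2 S \<phi>" unfolding \<phi>_def[abs_def] by (intro Ck_on_diff Ck_on_inner assms)
  moreover have "\<phi> y \<le> \<phi> x" if "y \<in> S" for y
    using tangent[OF that] by (simp add: \<phi>_def inner_diff_right inner_commute)
  ultimately have "dd v (dd v \<phi>) x \<le> 0"
    using dd_dd_at_local_max[OF assms(1,4)] by blast
  moreover have "dd v (dd v \<phi>) x = dd v (\<lambda>y. v \<bullet> grad u x - dd v u y) x"
    unfolding \<phi>_def[abs_def]
    by (rule dd_cong_open[OF assms(1,4)])
       (simp add: dd_sub d bounded_linear_imp_differentiable[OF bounded_linear_inner_left])
  moreover have "\<dots> = - dd v (dd v u) x"
    using assms(3,4) by (simp add: dd_sub numeral_2_eq_2 Ck_on_Suc)
  ultimately show ?thesis by simp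
qed

text \<open>Boundedness is what makes the real-valued supremum an upper bound.\<close>

lemma norm_le_sup_norm:
  assumes "bounded (g ` S)" "x \<in> S"
  shows "norm (g x) \<le> sup_norm S g"
proof -
  have "bdd_above ((\<lambda>x. norm (g x)) ` S)"
    using assms(1) unfolding bounded_iff bdd_above_def by auto
  then show ?thesis unfolding sup_norm_def using assms(2) by (rule cSUP_upper2) simp
qed

lemma dist_le_lip_seminorm:
  assumes "L-lipschitz_on S g" "x \<in> S" "y \<in> S"
  shows "dist (g x) (g y) \<le> lip_seminorm S g * dist x y"
proof (cases "x = y")
  case False
  have "dist (g x) (g y) / dist x y \<le> lip_seminorm S g"
    unfolding lip_seminorm_def
  proof (rule cSUP_upper2[of _ _ "(x, y)"])
    show "bdd_above ((\<lambda>(x, y). dist (g x) (g y) / dist x y) ` {(x, y). x \<in> S \<and> y \<in> S \<and> x \<noteq> y})"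
      using lipschitz_onD[OF assms(1)] by (auto intro!: bdd_aboveI[of _ L] simp: divide_le_eq)
  qed (use assms False in auto)
  then show ?thesis using False by (simp add: divide_le_eq)
qed simp

lemma lip_seminorm_nonneg:
  assumes "L-lipschitz_on S g" "x \<in> S" "y \<in> S" "x \<noteq> y"
  shows "0 \<le> lip_seminorm S g"
  using dist_le_lip_seminorm[OF assms(1-3)] assms(4)
  by (metis zero_le_dist dist_pos_lt order_trans zero_le_mult_iff linorder_not_le)

lemma norm_pair_le:
  fixes a :: "'a::real_normed_vector"
  assumes "\<bar>b\<bar> \<le> \<Lambda> * r" "norm a \<le> r"
  shows "norm (a, b) \<le> (1 + \<Lambda>) * r"
  using norm_Pair_le[of a b] assms by (simp add: algebra_simps)

lemma composed_rhs_derivative: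
  fixes f :: "'a::euclidean_space \<times> real \<Rightarrow> real"
  assumes "f differentiable (at (x, u x))" "u differentiable (at x)"
  shows "(\<lambda>y. f (y, u y)) differentiable (at x)"
    and "dd v (\<lambda>y. f (y, u y)) x = grad f (x, u x) \<bullet> (v, dd v u x)"
proof -
  have "((\<lambda>y. (y, u y)) has_derivative (\<lambda>v. (v, dd v u x))) (at x)"
    by (intro has_derivative_Pair has_derivative_ident has_derivative_dd assms)
  from has_derivative_compose[OF this has_derivative_dd[OF assms(1)]]
  have "((\<lambda>y. f (y, u y)) has_derivative (\<lambda>v. dd (v, dd v u x) f (x, u x))) (at x)" .
  then show "(\<lambda>y. f (y, u y)) differentiable (at x)"
    "dd v (\<lambda>y. f (y, u y)) x = grad f (x, u x) \<bullet> (v, dd v u x)"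
    using dd_eqI dd_eq_grad[OF assms(1)] unfolding differentiable_def by auto
qed

text \<open>The derivative of \<open>y \<mapsto> f(y, u(y))\<close> in direction \<open>v\<close> is the inner product of the gradient of \<open>f\<close> with
  \<open>(v, dd v u y)\<close>. In a difference quotient of it, the increment of the gradient is controlled by its
  Lipschitz constant, and the increment of \<open>dd v u\<close> is multiplied by the frozen partial derivative \<open>q\<close>
  of \<open>f\<close> in the last variable. Thus second derivatives of \<open>f\<close> never occur, and the second derivative of the
  composition differs from \<open>q\<close> times that of \<open>u\<close> by a bounded amount.\<close>

lemma composed_rhs_bounds:
  fixes f :: "'a::euclidean_space \<times> real \<Rightarrow> real"
  assumes S: "open S" "Ck_on 2 S u" "Ck_on 2 S (\<lambda>y. f (y, u y))"
    and f: "\<And>x. x \<in> S \<Longrightarrow> f differentiable (at (x, u x))"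
    and u_lip: "\<And>x y. x \<in> S \<Longrightarrow> y \<in> S \<Longrightarrow> \<bar>u x - u y\<bar> \<le> \<Lambda> * norm (x - y)"
    and grad_bound: "\<And>x. x \<in> S \<Longrightarrow> norm (grad f (x, u x)) \<le> K"
    and grad_lip: "\<And>x y. x \<in> S \<Longrightarrow> y \<in> S \<Longrightarrow>
        norm (grad f (x, u x) - grad f (y, u y)) \<le> K * norm ((x, u x) - (y, u y))"
    and nonneg: "0 \<le> \<Lambda>" "0 \<le> K" and x: "x \<in> S"
  shows "\<bar>dd v (\<lambda>y. f (y, u y)) x\<bar> \<le> K * (1 + \<Lambda>)\<^sup>2 * norm v"
    and "\<bar>dd v (dd v (\<lambda>y. f (y, u y))) x\<bar>
      \<le> K * (1 + \<Lambda>)\<^sup>2 * \<bar>dd v (dd v u) x\<bar> + K * (1 + \<Lambda>)\<^sup>2 * (norm v)\<^sup>2"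
proof -
  let ?F = "\<lambda>y. f (y, u y)"
  have du: "u differentiable (at y)" if "y \<in> S" for y
    using Ck_on_differentiable[OF S(2) _ that] by simp
  have dF: "dd v ?F y = grad f (y, u y) \<bullet> (v, dd v u y)" if "y \<in> S" for y
    by (rule composed_rhs_derivative[OF f[OF that] du[OF that]])
  have u1: "\<bar>dd v u y\<bar> \<le> \<Lambda> * norm v" if "y \<in> S" for y
    using that u_lip by (intro dd_le_of_lipschitz[OF S(1) _ du]) auto
  have pair: "norm (v, dd v u y) \<le> (1 + \<Lambda>) * norm v" if "y \<in> S" for y
    by (rule norm_pair_le[OF u1[OF that] order_refl])
  have \<Lambda>1: "1 + \<Lambda> \<le> (1 + \<Lambda>)\<^sup>2" "1 \<le> (1 + \<Lambda>)\<^sup>2"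
    using nonneg by (simp_all add: self_le_power)
  have KL: "K \<le> K * (1 + \<Lambda>)\<^sup>2" using mult_left_mono[OF \<Lambda>1(2) nonneg(2)] by simp
  have "\<bar>dd v ?F x\<bar> \<le> K * ((1 + \<Lambda>) * norm v)"
    unfolding dF[OF x] using nonneg
    by (intro order_trans[OF Cauchy_Schwarz_ineq2] mult_mono grad_bound pair x) auto
  also have "\<dots> \<le> K * ((1 + \<Lambda>)\<^sup>2 * norm v)"
    using \<Lambda>1 nonneg by (intro mult_left_mono mult_right_mono) auto
  finally show "\<bar>dd v ?F x\<bar> \<le> K * (1 + \<Lambda>)\<^sup>2 * norm v" by (simp add: mult.assoc)
  define q where "q = snd (grad f (x, u x))"
  have q: "\<bar>q\<bar> \<le> K"
    using norm_snd_le[of q "fst (grad f (x, u x))"] grad_bound[OF x] by (simp add: q_def)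
  have d2: "dd v ?F differentiable (at x)" "dd v u differentiable (at x)"
    using S(2,3) x by (auto simp: numeral_2_eq_2 Ck_on_Suc)
  (* Subtracting the frozen multiple leaves only the increment of the gradient of f. *)
  define \<psi> where "\<psi> t = dd v ?F (x + t *\<^sub>R v) - q * dd v u (x + t *\<^sub>R v)" for t
  have "\<bar>dd v (dd v ?F) x - q * dd v (dd v u) x\<bar> \<le> K * (1 + \<Lambda>)\<^sup>2 * (norm v)\<^sup>2"
  proof (rule real_derivative_le)
    show "(\<psi> has_real_derivative dd v (dd v ?F) x - q * dd v (dd v u) x) (at 0)"
      unfolding \<psi>_def
      using has_real_derivative_along_line[of "dd v ?F" x 0 v] has_real_derivative_along_line[of "dd v u" x 0 v] d2
      by (auto intro!: DERIV_diff DERIV_cmult)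
    show "\<forall>\<^sub>F t in at_right 0. \<bar>\<psi> t - \<psi> 0\<bar> \<le> K * (1 + \<Lambda>)\<^sup>2 * (norm v)\<^sup>2 * t"
      using eventually_ray_in_open[OF S(1) x, of v] eventually_at_right_less[of 0]
    proof eventually_elim
      case (elim t)
      let ?y = "x + t *\<^sub>R v"
      let ?g = "grad f (?y, u ?y) - grad f (x, u x)"
      have "\<psi> t - \<psi> 0 = ?g \<bullet> (v, dd v u ?y)"
        unfolding \<psi>_def dF[OF elim(1)] q_def using dF[OF x]
        by (cases "grad f (x, u x)") (simp add: inner_diff_left algebra_simps inner_prod_def)
      also have "\<bar>\<dots>\<bar> \<le> norm ?g * norm (v, dd v u ?y)" by (rule Cauchy_Schwarz_ineq2)
      also have "\<dots> \<le> (K * norm ((?y, u ?y) - (x, u x))) * ((1 + \<Lambda>) * norm v)"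
        using nonneg elim x by (intro mult_mono grad_lip pair) auto
      also have "\<dots> \<le> (K * ((1 + \<Lambda>) * (t * norm v))) * ((1 + \<Lambda>) * norm v)"
      proof -
        have "norm (t *\<^sub>R v, u ?y - u x) \<le> (1 + \<Lambda>) * (t * norm v)"
          using u_lip[OF elim(1) x] elim by (intro norm_pair_le) (auto simp: algebra_simps)
        then show ?thesis using nonneg by (intro mult_right_mono mult_left_mono) auto
      qed
      finally show ?case by (simp add: power2_eq_square algebra_simps)
    qed
  qed
  moreover have "\<bar>q * dd v (dd v u) x\<bar> \<le> K * (1 + \<Lambda>)\<^sup>2 * \<bar>dd v (dd v u) x\<bar>"
    unfolding abs_mult using q KL by (intro mult_right_mono) auto
  ultimately show "\<bar>dd v (dd v ?F) x\<bar>
      \<le> K * (1 + \<Lambda>)\<^sup>2 * \<bar>dd v (dd v u) x\<bar> + K * (1 + \<Lambda>)\<^sup>2 * (norm v)\<^sup>2"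
    by linarith
qed

lemma Ck_1_grad_bounded:
  fixes u :: "'a::euclidean_space \<Rightarrow> real"
  assumes "Ck_on 1 S u" "compact C" "C \<subseteq> S"
  shows "\<exists>L\<ge>0. \<forall>x\<in>C. norm (grad u x) \<le> L"
proof -
  have "continuous_on C (\<lambda>x. \<Sum>b\<in>Basis. dd b u x *\<^sub>R b)"
    using assms by (intro continuous_intros) (auto simp: Ck_on_Suc intro: continuous_on_subset)
  then have "bounded (grad u ` C)"
    using compact_imp_bounded compact_continuous_image assms(2)
    unfolding grad_def[abs_def] dd_def[symmetric] by blast
  then show ?thesis unfolding bounded_pos by (auto intro: less_imp_le)
qed

lemma Ck_1_lipschitz_on:
  fixes u :: "'a::euclidean_space \<Rightarrow> real"
  assumes "Ck_on 1 S u" "compact C" "convex C" "C \<subseteq> S"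
  shows "\<exists>L. L-lipschitz_on C u"
proof -
  obtain L where L: "L \<ge> 0" "\<And>x. x \<in> C \<Longrightarrow> norm (grad u x) \<le> L"
    using Ck_1_grad_bounded[OF assms(1,2,4)] by blast
  have d: "u differentiable (at x)" if "x \<in> C" for x
    using Ck_on_differentiable[OF assms(1)] assms(4) that by auto
  have "dist (u x) (u y) \<le> L * dist x y" if "x \<in> C" "y \<in> C" for x y
    unfolding dist_norm
  proof (rule differentiable_bound[OF assms(3) _ _ that(1,2)])
    fix z assume z: "z \<in> C"
    show "(u has_derivative (\<lambda>v. dd v u z)) (at z within C)"
      by (rule has_derivative_at_withinI[OF has_derivative_dd[OF d[OF z]]])
    show "onorm (\<lambda>v. dd v u z) \<le> L"
    proof (rule onorm_bound[OF L(1)])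
      fix v
      show "norm (dd v u z) \<le> L * norm v"
        unfolding dd_eq_grad[OF d[OF z]] real_norm_def
        by (rule order_trans[OF Cauchy_Schwarz_ineq2]) (intro mult_right_mono L z norm_ge_zero)
    qed
  qed
  then show ?thesis using L by (auto intro: lipschitz_onI)
qed

section \<open>Orthonormal frames of the plane\<close>

abbreviation hess :: "2 \<Rightarrow> 2 \<Rightarrow> (real^2 \<Rightarrow> real) \<Rightarrow> real^2 \<Rightarrow> real" where
  "hess i j u \<equiv> dd (axis j 1) (dd (axis i 1) u)"

lemma hessian_nth: "hessian u x $ i $ j = hess i j u x"
  by (simp add: hessian_def pderiv_at_def[abs_def] dd_def[abs_def])

definition frame_vec :: "real \<Rightarrow> real \<Rightarrow> real^2" where
  "frame_vec a b = a *\<^sub>R axis 1 1 + b *\<^sub>R axis 2 1"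

lemma inner_axes: "axis 1 1 \<bullet> (axis 1 1 :: real^2) = 1" "axis 2 1 \<bullet> (axis 2 1 :: real^2) = 1"
  "axis 1 1 \<bullet> (axis 2 1 :: real^2) = 0" "axis 2 1 \<bullet> (axis 1 1 :: real^2) = 0"
  by (simp_all add: inner_axis_axis)

lemma inner_frame_vec: "frame_vec a b \<bullet> frame_vec c d = a * c + b * d"
  by (simp add: frame_vec_def inner_simps inner_axes)

lemma frame_vec_components: "x = frame_vec (x $ 1) (x $ 2)"
  by (simp add: frame_vec_def vec_eq_iff forall_2 axis_def)

lemma dd_dd_frame_vec:
  assumes "open S" "Ck_on 2 S u" "x \<in> S"
  shows "dd (frame_vec a b) (dd (frame_vec c d) u) x
       = a * c * hess 1 1 u x + (a * d + b * c) * hess 1 2 u x + b * d * hess 2 2 u x"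
proof -
  have du: "u differentiable (at y)" if "y \<in> S" for y
    using Ck_on_differentiable[OF assms(2) _ that] by simp
  have ddu: "dd v u differentiable (at x)" for v
    using assms by (simp add: numeral_2_eq_2 Ck_on_Suc)
  have "dd v (dd (frame_vec c d) u) x = c * dd v (dd (axis 1 1) u) x + d * dd v (dd (axis 2 1) u) x" for v
  proof -
    have "dd v (dd (frame_vec c d) u) x = dd v (\<lambda>y. c * dd (axis 1 1) u y + d * dd (axis 2 1) u y) x"
      unfolding frame_vec_def by (intro dd_cong_open[OF assms(1,3)] dd_comb du)
    then show ?thesis using ddu by (simp add: dd_add dd_mult)
  qed
  moreover have "hess 2 1 u x = hess 1 2 u x" by (rule dd_commute[OF assms])
  ultimately show ?thesis
    unfolding frame_vec_def[of a b] dd_comb[OF ddu] by (simp add: algebra_simps)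
qed

section \<open>The interior estimate\<close>

text \<open>A convex solution with positive right-hand side has positive trace (it is nonnegative, and a
  vanishing trace would make the quotient \<open>0\<close>), hence positive determinant.\<close>

lemma quotient_solution:
  fixes u :: "real^2 \<Rightarrow> real"
  assumes S: "open S" and C2: "Ck_on 2 S u" and convex: "convex_on S u"
    and eq: "\<And>x. x \<in> S \<Longrightarrow> sigma2 (hessian u x) / sigma1 (hessian u x) = F x"
    and F: "\<And>x. x \<in> S \<Longrightarrow> 0 < F x" and x: "x \<in> S"
  shows "0 < hess 1 1 u x + hess 2 2 u x"
    and "hess 1 1 u x * hess 2 2 u x - (hess 1 2 u x)\<^sup>2 = F x * (hess 1 1 u x + hess 2 2 u x)"
    and "0 < hess 1 1 u x * hess 2 2 u x - (hess 1 2 u x)\<^sup>2"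
proof -
  have "hess 2 1 u x = hess 1 2 u x" by (rule dd_commute[OF S C2 x])
  then have det: "sigma2 (hessian u x) = hess 1 1 u x * hess 2 2 u x - (hess 1 2 u x)\<^sup>2"
    by (simp add: sigma2_def det_2 hessian_nth power2_eq_square)
  have trace: "sigma1 (hessian u x) = hess 1 1 u x + hess 2 2 u x"
    by (simp add: sigma1_def trace_def sum_2 hessian_nth)
  have "hess 1 1 u x + hess 2 2 u x \<noteq> 0" using eq[OF x] F[OF x] unfolding trace by auto
  with convex_on_imp_dd_dd_nonneg[OF S convex C2 x, of "axis 1 1"]
    convex_on_imp_dd_dd_nonneg[OF S convex C2 x, of "axis 2 1"]
  show T: "0 < hess 1 1 u x + hess 2 2 u x" by linarith
  then show D: "hess 1 1 u x * hess 2 2 u x - (hess 1 2 u x)\<^sup>2 = F x * (hess 1 1 u x + hess 2 2 u x)"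
    using eq[OF x] unfolding trace det by (simp add: field_simps)
  show "0 < hess 1 1 u x * hess 2 2 u x - (hess 1 2 u x)\<^sup>2" unfolding D using F[OF x] T by simp
qed

text \<open>The right-hand side, evaluated along a solution, is a rational function of the second derivatives of \<open>u\<close>
  and inherits their smoothness. This is why second derivatives of the composition make sense for
  merely Lipschitz gradients of \<open>f\<close>.\<close>

lemma Ck_on_quotient_rhs:
  fixes u :: "real^2 \<Rightarrow> real"
  assumes S: "open S" and u: "Ck_on 4 S u" "convex_on S u"
    and eq: "\<And>x. x \<in> S \<Longrightarrow> sigma2 (hessian u x) / sigma1 (hessian u x) = F x"
    and F: "\<And>x. x \<in> S \<Longrightarrow> 0 < F x"
  shows "Ck_on 2 S F"
proof (rule Ck_on_cong_open[OF S])
  have C2: "Ck_on 2 S u" using Ck_on_mono[OF u(1)] by simp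
  have T: "0 < hess 1 1 u x + hess 2 2 u x" if "x \<in> S" for x
    by (rule quotient_solution(1)[OF S C2 u(2) eq F that])
  have C: "Ck_on 2 S (hess i j u)" for i j
    using u(1) by (auto simp: eval_nat_numeral Ck_on_Suc)
  show "Ck_on 2 S (\<lambda>x. (hess 1 1 u x * hess 2 2 u x - hess 1 2 u x * hess 1 2 u x) * inverse (hess 1 1 u x + hess 2 2 u x))"
    by (intro Ck_on_mult Ck_on_diff Ck_on_inverse Ck_on_add C S T)
  show "(hess 1 1 u x * hess 2 2 u x - hess 1 2 u x * hess 1 2 u x) * inverse (hess 1 1 u x + hess 2 2 u x) = F x"
    if "x \<in> S" for x
    using T[OF that] unfolding power2_eq_square[symmetric]
    by (subst quotient_solution(2)[OF S C2 u(2) eq F that]) auto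
qed

text \<open>The estimate \<open>wee_0_ge\<close> for the frame obtained by rotating the standard basis, rewritten in standard
  coordinates: the right-hand side is the second derivative of \<open>u\<close> in the direction \<open>(- b, a)\<close>, which is the determinant
  times \<open>wee\<close>.\<close>

lemma inverse_hessian_lower_bound:
  fixes u :: "real^2 \<Rightarrow> real"
  assumes S: "open S" "cball 0 1 \<subseteq> S" and u: "Ck_on 4 S u" "convex_on S u"
    and eq: "\<And>x. x \<in> S \<Longrightarrow> sigma2 (hessian u x) / sigma1 (hessian u x) = F x"
    and m: "0 < m" "\<And>x. x \<in> S \<Longrightarrow> m \<le> F x"
    and K: "\<And>x v. x \<in> S \<Longrightarrow> \<bar>dd v F x\<bar> \<le> K * norm v"
    and K2: "\<And>x v. x \<in> S \<Longrightarrow> \<bar>dd v (dd v F) x\<bar> \<le> K * \<bar>dd v (dd v u) x\<bar> + K * (norm v)\<^sup>2"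
    and "0 \<le> K" and \<Lambda>: "0 \<le> \<Lambda>" "\<And>x v. x \<in> S \<Longrightarrow> \<bar>dd v u x\<bar> \<le> \<Lambda> * norm v"
    and unit: "a\<^sup>2 + b\<^sup>2 = 1"
  shows "c_const (H_const m) (B_const m K) (1 + 2 * \<Lambda>)
           * (hess 1 1 u 0 * hess 2 2 u 0 - (hess 1 2 u 0)\<^sup>2)
         \<le> b\<^sup>2 * hess 1 1 u 0 - 2 * a * b * hess 1 2 u 0 + a\<^sup>2 * hess 2 2 u 0"
proof -
  let ?e = "frame_vec a b" and ?n = "frame_vec (- b) a"
  let ?uee = "dd ?e (dd ?e u)" and ?uen = "dd ?n (dd ?e u)" and ?unn = "dd ?n (dd ?n u)"
  have C2: "Ck_on 2 S u" using Ck_on_mono[OF u(1)] by simp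
  note expand = dd_dd_frame_vec[OF S(1) C2]
  have invariants: "?uee x + ?unn x = hess 1 1 u x + hess 2 2 u x"
    "?uee x * ?unn x - (?uen x)\<^sup>2 = hess 1 1 u x * hess 2 2 u x - (hess 1 2 u x)\<^sup>2"
    if "x \<in> S" for x
    unfolding expand[OF that] using unit by algebra+
  have nonneg: "0 \<le> dd v (dd v u) x" if "x \<in> S" for x v
    by (rule convex_on_imp_dd_dd_nonneg[OF S(1) u(2) C2 that])
  have Fpos: "0 < F x" if "x \<in> S" for x using m that by force
  have D: "hess 1 1 u x * hess 2 2 u x - (hess 1 2 u x)\<^sup>2 = F x * (hess 1 1 u x + hess 2 2 u x)"
    and Dpos: "0 < hess 1 1 u x * hess 2 2 u x - (hess 1 2 u x)\<^sup>2" if "x \<in> S" for x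
    by (rule quotient_solution(2,3)[OF S(1) C2 u(2) eq Fpos that]; assumption)+
  interpret hessian_frame S u ?e ?n
  proof
    show "?e \<bullet> ?e = 1" "?n \<bullet> ?n = 1" "?e \<bullet> ?n = 0"
      using unit by (simp_all add: inner_frame_vec power2_eq_square)
    show "(x \<bullet> ?e) *\<^sub>R ?e + (x \<bullet> ?n) *\<^sub>R ?n = x" for x
    proof -
      have "(s * a + t * b) * a + (- (s * b) + t * a) * - b = s * (a\<^sup>2 + b\<^sup>2)"
        "(s * a + t * b) * b + (- (s * b) + t * a) * a = t * (a\<^sup>2 + b\<^sup>2)" for s t :: real
        by (simp_all add: power2_eq_square algebra_simps)
      then have "(frame_vec s t \<bullet> ?e) *\<^sub>R ?e + (frame_vec s t \<bullet> ?n) *\<^sub>R ?n = frame_vec s t" for s t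
        using unit unfolding inner_frame_vec
        by (simp add: vec_eq_iff forall_2 frame_vec_def axis_def)
      then show ?thesis by (metis frame_vec_components)
    qed
    fix x assume x: "x \<in> S"
    show d: "0 < ?uee x * ?unn x - (?uen x)\<^sup>2" unfolding invariants[OF x] by (rule Dpos[OF x])
    then have "?uee x * ?unn x \<noteq> 0" using zero_le_power2[of "?uen x"] by linarith
    then show "0 < ?uee x" "0 < ?unn x" using nonneg[OF x] by (auto simp: less_le)
  qed (use S u in auto)
  have e1: "norm ?e = 1" "norm ?n = 1" using frame by (simp_all add: norm_eq_1)
  have "bounded_hessian_frame S u ?e ?n (H_const m) (B_const m K) (1 + 2 * \<Lambda>)"
  proof (rule bounded_frame_of_quotient_equation[of F])
    show "F x * (?uee x + ?unn x) = ?uee x * ?unn x - (?uen x)\<^sup>2" if "x \<in> S" for x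
      unfolding invariants[OF that] D[OF that] ..
    show "(dd ?e u x)\<^sup>2 + (dd ?n u x)\<^sup>2 \<le> (1 + 2 * \<Lambda>)\<^sup>2" if "x \<in> S" for x
    proof -
      have "(dd ?e u x)\<^sup>2 \<le> \<Lambda>\<^sup>2" "(dd ?n u x)\<^sup>2 \<le> \<Lambda>\<^sup>2"
        using \<Lambda>(2)[OF that, of ?e] \<Lambda>(2)[OF that, of ?n] \<Lambda>(1)
        by (simp_all add: e1 abs_le_square_iff[symmetric])
      moreover have "(1 + 2 * \<Lambda>)\<^sup>2 = 1 + 4 * \<Lambda> + 4 * \<Lambda>\<^sup>2" by (simp add: power2_eq_square algebra_simps)
      ultimately show ?thesis using \<Lambda>(1) zero_le_power2[of \<Lambda>] by linarith
    qed
  qed (use assms in auto)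
  then interpret bounded_hessian_frame S u ?e ?n "H_const m" "B_const m K" "1 + 2 * \<Lambda>" .
  have 0: "0 \<in> S" using S(2) by auto
  have "J 0 * (hess 1 1 u 0 * hess 2 2 u 0 - (hess 1 2 u 0)\<^sup>2) = 1"
    using J_eq[OF 0] invariants(2)[OF 0] by (simp add: power2_eq_square)
  then have "wee 0 * (hess 1 1 u 0 * hess 2 2 u 0 - (hess 1 2 u 0)\<^sup>2) = ?unn 0"
    unfolding wee_def by (simp add: mult.assoc)
  moreover have "c_const (H_const m) (B_const m K) (1 + 2 * \<Lambda>) * (hess 1 1 u 0 * hess 2 2 u 0 - (hess 1 2 u 0)\<^sup>2)
      \<le> wee 0 * (hess 1 1 u 0 * hess 2 2 u 0 - (hess 1 2 u 0)\<^sup>2)"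
    using wee_0_ge Dpos[OF 0] by (intro mult_right_mono) auto
  moreover have "?unn 0 = b\<^sup>2 * hess 1 1 u 0 - 2 * a * b * hess 1 2 u 0 + a\<^sup>2 * hess 2 2 u 0"
    unfolding expand[OF 0] by (simp add: power2_eq_square algebra_simps)
  ultimately show "c_const (H_const m) (B_const m K) (1 + 2 * \<Lambda>)
           * (hess 1 1 u 0 * hess 2 2 u 0 - (hess 1 2 u 0)\<^sup>2)
         \<le> b\<^sup>2 * hess 1 1 u 0 - 2 * a * b * hess 1 2 u 0 + a\<^sup>2 * hess 2 2 u 0"
    by simp
qed

text \<open>The hypothesis bounds the inverse of a positive symmetric matrix from below by \<open>c\<close>. Applied in the
  directions of the rows of the matrix, which the inverse maps to the standard basis, it bounds the diagonal
  entries by \<open>1 / c\<close>; this avoids eigenvectors.\<close>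

lemma entries_bounded_of_inverse_bound:
  fixes c h11 h12 h22 :: real
  assumes c: "0 < c" and D: "0 < h11 * h22 - h12\<^sup>2"
    and bound: "\<And>a b. a\<^sup>2 + b\<^sup>2 = 1 \<Longrightarrow>
      c * (h11 * h22 - h12\<^sup>2) \<le> b\<^sup>2 * h11 - 2 * a * b * h12 + a\<^sup>2 * h22"
  shows "\<bar>h11\<bar> \<le> 1 / c" "\<bar>h12\<bar> \<le> 1 / c" "\<bar>h22\<bar> \<le> 1 / c"
proof -
  let ?D = "h11 * h22 - h12\<^sup>2"
  have *: "c * (a\<^sup>2 + b\<^sup>2) * ?D \<le> b\<^sup>2 * h11 - 2 * a * b * h12 + a\<^sup>2 * h22" for a b
  proof (cases "a\<^sup>2 + b\<^sup>2 = 0")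
    case False
    define r where "r = sqrt (a\<^sup>2 + b\<^sup>2)"
    have "0 \<le> a\<^sup>2 + b\<^sup>2" by simp
    with False have r: "r\<^sup>2 = a\<^sup>2 + b\<^sup>2" "0 < r\<^sup>2" unfolding r_def by (simp_all add: less_le)
    then have r0: "r \<noteq> 0" by auto
    have "(a / r)\<^sup>2 + (b / r)\<^sup>2 = (a\<^sup>2 + b\<^sup>2) / r\<^sup>2"
      by (simp add: power_divide add_divide_distrib)
    then have "(a / r)\<^sup>2 + (b / r)\<^sup>2 = 1"
      unfolding r(1)[symmetric] using r(2) by simp
    from mult_left_mono[OF bound[OF this] less_imp_le[OF r(2)]]
    have "r\<^sup>2 * (c * ?D) \<le> r\<^sup>2 * ((b / r)\<^sup>2 * h11 - 2 * (a / r) * (b / r) * h12 + (a / r)\<^sup>2 * h22)" .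
    also have "\<dots> = b\<^sup>2 * h11 - 2 * a * b * h12 + a\<^sup>2 * h22"
      using r0 by (simp add: power2_eq_square field_simps)
    finally show ?thesis unfolding r(1)[symmetric] by (simp add: algebra_simps)
  qed simp
  (* For a row (a, b) of the matrix, the quadratic form on the right is a diagonal entry times the determinant. *)
  have "c * (h11\<^sup>2 + h12\<^sup>2) * ?D \<le> h11 * ?D" "c * (h12\<^sup>2 + h22\<^sup>2) * ?D \<le> h22 * ?D"
    using *[of h11 h12] *[of h12 h22] by (simp_all add: power2_eq_square algebra_simps)
  then have 1: "c * (h11\<^sup>2 + h12\<^sup>2) \<le> h11" and 2: "c * (h12\<^sup>2 + h22\<^sup>2) \<le> h22"
    using D mult_right_le_imp_le by blast+
  have bd: "\<bar>x\<bar> \<le> 1 / c" if "c * (x\<^sup>2 + y\<^sup>2) \<le> x" for x y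
  proof -
    have "0 \<le> c * (x\<^sup>2 + y\<^sup>2)" "c * x\<^sup>2 \<le> c * (x\<^sup>2 + y\<^sup>2)" using c by (simp_all add: mult_left_mono)
    with that have x: "0 \<le> x" "c * x * x \<le> 1 * x" by (simp_all add: power2_eq_square)
    then have "c * x \<le> 1" by (cases "x = 0") (auto intro: mult_right_le_imp_le)
    then show ?thesis using x c by (simp add: field_simps)
  qed
  show b11: "\<bar>h11\<bar> \<le> 1 / c" by (rule bd[OF 1])
  show "\<bar>h22\<bar> \<le> 1 / c" using bd[of h22 h12] 2 by (simp add: add.commute)
  have "c * h12\<^sup>2 \<le> c * (h11\<^sup>2 + h12\<^sup>2)" using c by (simp add: mult_left_mono)
  then have "c * h12\<^sup>2 \<le> 1 / c" using 1 b11 by linarith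
  then have "h12\<^sup>2 \<le> (1 / c)\<^sup>2" using c by (simp add: power2_eq_square field_simps)
  then show "\<bar>h12\<bar> \<le> 1 / c" using c abs_le_square_iff[of h12 "1 / c"] by simp
qed

lemma norm_le_entries:
  fixes A :: "real^2^2"
  assumes "\<And>i j. \<bar>A $ i $ j\<bar> \<le> c"
  shows "norm A \<le> 4 * c"
proof -
  have "norm A \<le> (\<Sum>i\<in>UNIV. norm (A $ i))"
    unfolding norm_vec_def by (rule L2_set_le_sum) simp
  also have "\<dots> \<le> (\<Sum>i\<in>UNIV. \<Sum>j\<in>UNIV. \<bar>A $ i $ j\<bar>)"
    by (intro sum_mono norm_le_l1_cart)
  also have "\<dots> \<le> 4 * c" using assms[of 1 1] assms[of 1 2] assms[of 2 1] assms[of 2 2] by (simp add: sum_2)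
  finally show ?thesis .
qed

definition C_const :: "real \<Rightarrow> real \<Rightarrow> real \<Rightarrow> real" where
  "C_const \<Lambda> m K = 4 * (1 / c_const (H_const m) (B_const m (K * (1 + \<Lambda>)\<^sup>2)) (1 + 2 * \<Lambda>))"

text \<open>The work is to see that all suprema and the infimum are taken over bounded sets, so that the norms give
  pointwise bounds on \<open>u\<close>, \<open>f\<close> and their derivatives over the ball of radius \<open>9\<close>, to which the estimates above apply.\<close>

theorem hessian_estimate:
  fixes f :: "(real ^ 2) \<times> real \<Rightarrow> real" and u :: "real ^ 2 \<Rightarrow> real" and M :: real
  assumes f: "C11_on (ball 0 10 \<times> UNIV) f" "\<And>q. q \<in> ball 0 10 \<times> UNIV \<Longrightarrow> 0 < f q"
    and sol: "convex_C4_solution (ball 0 10) f u" and M: "sup_norm (cball 0 9) u \<le> M"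
  shows "norm (hessian u 0) \<le> C_const (C01_norm (cball 0 9) u)
      (INF q \<in> cball 0 9 \<times> {-M..M}. f q) (C11_norm (cball 0 9 \<times> {-M..M}) f)"
proof -
  let ?B = "cball 0 9 :: (real^2) set" and ?O = "ball 0 10 \<times> UNIV :: ((real^2) \<times> real) set"
  let ?Q = "cball 0 9 \<times> {-M..M} :: ((real^2) \<times> real) set"
  define \<Lambda> where "\<Lambda> = C01_norm ?B u"
  define m where "m = (INF q \<in> ?Q. f q)"
  define K where "K = C11_norm ?Q f"
  define S where "S = (ball 0 9 :: (real^2) set)"
  define F where "F = (\<lambda>x. f (x, u x))"
  have S: "open S" "cball 0 1 \<subseteq> S" "S \<subseteq> ?B" "S \<subseteq> ball 0 10" "?B \<subseteq> ball 0 10" by (auto simp: S_def)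
  have u4: "Ck_on 4 (ball 0 10) u" and cvx: "convex_on (ball 0 10) u"
    and eq: "\<And>x. x \<in> ball 0 10 \<Longrightarrow> sigma2 (hessian u x) / sigma1 (hessian u x) = f (x, u x)"
    using sol by (auto simp: convex_C4_solution_def)
  have u1: "Ck_on 1 (ball 0 10) u" and u2: "Ck_on 2 S u" and u4S: "Ck_on 4 S u"
    using Ck_on_mono[OF u4] Ck_on_subset[OF _ S(4)] u4 by auto
  note cont_u = continuous_on_subset[OF Ck_on_imp_continuous[OF u4] S(5)]
  have bounded_u: "bounded (u ` ?B)"
    using compact_imp_bounded compact_continuous_image[OF cont_u] by simp
  have u_le: "\<bar>u x\<bar> \<le> M" if "x \<in> ?B" for x
    using norm_le_sup_norm[OF bounded_u that] M by simp
  then have in_Q: "(x, u x) \<in> ?Q" if "x \<in> ?B" for x using that by (force simp: abs_le_iff)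
  (* The Lipschitz seminorms are suprema over pairs of distinct points, so they are nonnegative as such pairs exist. *)
  have two_points: "(0::real^2) \<in> ?B" "axis 1 1 \<in> ?B" "(0::real^2) \<noteq> axis 1 1"
    by (auto simp: axis_eq_0_iff norm_axis_1)
  obtain L1 where L1: "L1-lipschitz_on ?B u"
    using Ck_1_lipschitz_on[OF u1 _ _ S(5)] by auto
  have "0 \<le> sup_norm ?B u"
    using norm_le_sup_norm[OF bounded_u two_points(1)] norm_ge_zero order_trans by blast
  then have lip\<Lambda>: "lip_seminorm ?B u \<le> \<Lambda>" and \<Lambda>0: "0 \<le> \<Lambda>"
    using lip_seminorm_nonneg[OF L1 two_points] by (auto simp: \<Lambda>_def C01_norm_def)
  have u_lip: "\<bar>u x - u y\<bar> \<le> \<Lambda> * norm (x - y)" if "x \<in> S" "y \<in> S" for x y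
  proof -
    have "dist (u x) (u y) \<le> lip_seminorm ?B u * dist x y"
      using that S(3) by (intro dist_le_lip_seminorm[OF L1]) auto
    also have "\<dots> \<le> \<Lambda> * dist x y" using lip\<Lambda> by (intro mult_right_mono) auto
    finally show ?thesis by (simp add: dist_norm)
  qed
  have compact_Q: "compact ?Q" and Q_sub: "?Q \<subseteq> ?O"
    using S(5) by (auto intro: compact_Times)
  have f1: "Ck_on 1 ?O f" using f(1) by (simp add: C11_on_def)
  have df: "f differentiable (at q)" if "q \<in> ?O" for q
    using Ck_on_differentiable[OF f1 _ that] by simp
  obtain L2 where L2: "L2-lipschitz_on ?Q (grad f)"
    using f(1) compact_Q Q_sub unfolding C11_on_def by blast
  have cont_f: "continuous_on ?Q f"
    using continuous_on_subset[OF Ck_on_imp_continuous[OF f1] Q_sub] .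
  have bounded_f: "bounded (f ` ?Q)" and bounded_grad: "bounded (grad f ` ?Q)"
    using compact_imp_bounded compact_continuous_image[OF _ compact_Q] cont_f
      lipschitz_on_continuous_on[OF L2] by blast+
  have Q2: "(0, u 0) \<in> ?Q" "(axis 1 1, u (axis 1 1)) \<in> ?Q" "(0 :: real^2, u 0) \<noteq> (axis 1 1, u (axis 1 1))"
    using in_Q[OF two_points(1)] in_Q[OF two_points(2)] two_points(3) by simp_all
  have K_parts: "0 \<le> sup_norm ?Q f" "0 \<le> sup_norm ?Q (grad f)" "0 \<le> lip_seminorm ?Q (grad f)"
    using norm_le_sup_norm[OF bounded_f Q2(1)] norm_le_sup_norm[OF bounded_grad Q2(1)]
      lip_seminorm_nonneg[OF L2 Q2] norm_ge_zero order_trans by blast+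
  then have K: "0 \<le> K" "sup_norm ?Q (grad f) \<le> K" "lip_seminorm ?Q (grad f) \<le> K"
    by (auto simp: K_def C11_norm_def)
  have grad_bound: "norm (grad f (x, u x)) \<le> K" if "x \<in> S" for x
    using norm_le_sup_norm[OF bounded_grad in_Q[of x]] that S(3) K(2) by force
  have grad_lip: "norm (grad f (x, u x) - grad f (y, u y)) \<le> K * norm ((x, u x) - (y, u y))"
    if "x \<in> S" "y \<in> S" for x y
  proof -
    have "dist (grad f (x, u x)) (grad f (y, u y)) \<le> lip_seminorm ?Q (grad f) * dist (x, u x) (y, u y)"
      using that S(3) by (intro dist_le_lip_seminorm[OF L2] in_Q) auto
    also have "\<dots> \<le> K * dist (x, u x) (y, u y)" using K(3) by (intro mult_right_mono) auto
    finally show ?thesis by (simp add: dist_norm)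
  qed
  obtain q0 where q0: "q0 \<in> ?Q" "\<And>q. q \<in> ?Q \<Longrightarrow> f q0 \<le> f q"
    using continuous_attains_inf[OF compact_Q _ cont_f] Q2(1) by blast
  have "f q0 \<le> m" unfolding m_def using Q2(1) q0(2) by (intro cINF_greatest) auto
  then have m0: "0 < m" using f(2)[of q0] q0(1) Q_sub by fastforce
  have m_le: "m \<le> F x" if "x \<in> S" for x
    unfolding m_def F_def using that S(3) q0(2) in_Q by (intro cINF_lower) (auto intro!: bdd_belowI2[of _ "f q0"])
  have cvxS: "convex_on S u" by (rule convex_on_subset[OF cvx S(4)]) (simp add: S_def)
  have eqS: "sigma2 (hessian u x) / sigma1 (hessian u x) = F x" if "x \<in> S" for x
    using eq that S(4) by (auto simp: F_def)
  have Fpos: "0 < F x" if "x \<in> S" for x using m0 m_le[OF that] by linarith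
  have F2: "Ck_on 2 S F" by (rule Ck_on_quotient_rhs[OF S(1) u4S cvxS eqS Fpos])
  have dfS: "f differentiable (at (x, u x))" if "x \<in> S" for x
    using df[of "(x, u x)"] that S(4) by auto
  have F_bounds: "\<bar>dd v F x\<bar> \<le> K * (1 + \<Lambda>)\<^sup>2 * norm v"
    "\<bar>dd v (dd v F) x\<bar> \<le> K * (1 + \<Lambda>)\<^sup>2 * \<bar>dd v (dd v u) x\<bar> + K * (1 + \<Lambda>)\<^sup>2 * (norm v)\<^sup>2"
    if "x \<in> S" for x v
    unfolding F_def
    by (rule composed_rhs_bounds[OF S(1) u2 F2[unfolded F_def] dfS u_lip grad_bound grad_lip \<Lambda>0 K(1) that]; assumption)+
  have du: "\<bar>dd v u x\<bar> \<le> \<Lambda> * norm v" if "x \<in> S" for x v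
    using u_lip that by (intro dd_le_of_lipschitz[OF S(1)] Ck_on_differentiable[OF u2]) auto
  let ?c = "c_const (H_const m) (B_const m (K * (1 + \<Lambda>)\<^sup>2)) (1 + 2 * \<Lambda>)"
  have K': "0 \<le> K * (1 + \<Lambda>)\<^sup>2" using K(1) by simp
  let ?D = "hess 1 1 u 0 * hess 2 2 u 0 - (hess 1 2 u 0)\<^sup>2"
  have lower: "?c * ?D \<le> b\<^sup>2 * hess 1 1 u 0 - 2 * a * b * hess 1 2 u 0 + a\<^sup>2 * hess 2 2 u 0"
    if "a\<^sup>2 + b\<^sup>2 = 1" for a b
    by (rule inverse_hessian_lower_bound[OF S(1,2) u4S cvxS eqS m0 m_le F_bounds K' \<Lambda>0 du that])
  have S0: "0 \<in> S" by (simp add: S_def)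
  have D: "0 < ?D" by (rule quotient_solution(3)[OF S(1) u2 cvxS eqS Fpos S0])
  have entries: "\<bar>hess 1 1 u 0\<bar> \<le> 1 / ?c" "\<bar>hess 1 2 u 0\<bar> \<le> 1 / ?c" "\<bar>hess 2 2 u 0\<bar> \<le> 1 / ?c"
    by (rule entries_bounded_of_inverse_bound[OF c_const_pos D lower]; assumption)+
  have "hess 2 1 u 0 = hess 1 2 u 0"
    by (rule dd_commute[OF S(1) u2 S0])
  then have "\<bar>hessian u 0 $ i $ j\<bar> \<le> 1 / ?c" for i j
    using entries exhaust_2[of i] exhaust_2[of j] unfolding hessian_nth by auto
  from norm_le_entries[OF this] show ?thesis
    unfolding C_const_def \<Lambda>_def m_def K_def .
qed

theorem theorem1p3:
  "\<exists>C :: real \<Rightarrow> real \<Rightarrow> real \<Rightarrow> real.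
     \<forall>(f :: (real ^ 2) \<times> real \<Rightarrow> real) (u :: real ^ 2 \<Rightarrow> real) (M :: real).
       C11_on (ball 0 10 \<times> UNIV) f \<and>
       (\<forall>p \<in> ball 0 10 \<times> UNIV. 0 < f p) \<and>
       convex_C4_solution (ball 0 10) f u \<and>
       sup_norm (cball 0 9) u \<le> M
       \<longrightarrow> norm (hessian u 0)
             \<le> C (C01_norm (cball 0 9) u)
                  (INF p \<in> cball 0 9 \<times> {-M..M}. f p)
                  (C11_norm (cball 0 9 \<times> {-M..M}) f)"
  using hessian_estimate by (intro exI[of _ C_const]) blast

end
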